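(* Let $n\ge 2$, let $\mathcal{H}_1,\dots,\mathcal{H}_n$ be infinite dimensional complex Hilbert spaces, and let $D_s\in\mathcal{B}(\mathcal{H}_s)$ for $1\le s\le n$. Consider the following statements. (i) Both of the following hold: (a) $D_1\in\Phi_+(\mathcal{H}_1)$ and $D_n\in\Phi_-(\mathcal{H}_n)$; (b) either [$\mathcal{R}(D_s)$ is closed for $2\le s\le n-1$, and ($\alpha(D_s)=\beta(D_{s-1})$ for all $2\le s\le n$, or $\alpha(D_s)\le\beta(D_{s-1})<\infty$ for all $2\le s\le n$)], or [$D_j\in\Phi_+(\mathcal{H}_j)$ for $2\le j\le n$ and $D_k\in\Phi_-(\mathcal{H}_k)$ for $1\le k\le n-1$]. (ii) There exists $A\in\mathcal{B}_n$ such that $T_n^d(A)\in\Phi(\mathcal{H}_1\oplus\cdots\oplus\mathcal{H}_n)$. (iii) Both of the following hold: (a) $D_1\in\Phi_+(\mathcal{H}_1)$ and $D_n\in\Phi_-(\mathcal{H}_n)$; (b) either [there are $j\in\{1,\dots,n-1\}$ and $k\in\{2,\dots,n\}$ with $k>j$ such that $\beta(D_j)=\infty$, $\alpha(D_s)<\infty$ for $2\le s\le j$, $\alpha(D_k)=\infty$, and $\beta(D_s)<\infty$ for $k\le s\le n-1$ (the condition for $2\le s\le j$ being omitted if $j=1$, and the condition for $k\le s\le n-1$ being omitted if $k=n$)], or [$D_j\in\Phi_+(\mathcal{H}_j)$ for $2\le j\le n$ and $D_k\in\Phi_-(\mathcal{H}_k)$ for $1\le k\le n-1$]. Then (i) $\Rightarrow$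 (ii) $\Rightarrow$ (iii).
   Context: $\mathcal{B}(\mathcal{H},\mathcal{K})$ is the space of bounded linear operators from $\mathcal{H}$ to $\mathcal{K}$, and $\mathcal{B}(\mathcal{H})=\mathcal{B}(\mathcal{H},\mathcal{H})$. $\mathcal{N}(T)$ and $\mathcal{R}(T)$ are the kernel and range of $T$. $\mathcal{B}_n$ is the set of all tuples $A=(A_{ij})_{1\le i<j\le n}$ with $A_{ij}\in\mathcal{B}(\mathcal{H}_j,\mathcal{H}_i)$. Given $D_1,\dots,D_n$ and $A\in\mathcal{B}_n$, $T_n^d(A)\in\mathcal{B}(\mathcal{H}_1\oplus\cdots\oplus\mathcal{H}_n)$ is the upper triangular block operator matrix with diagonal entries $D_1,\dots,D_n$, entry $A_{ij}$ in position $(i,j)$ for $i<j$, and $0$ in position $(i,j)$ for $i>j$. For $T\in\mathcal{B}(\mathcal{H})$: $\alpha(T)=\dim\mathcal{N}(T)$ and $\beta(T)=\dim\mathcal{H}/\mathcal{R}(T)$. Dimensions of Hilbert spaces are Hilbert (orthogonal) dimensions, compared as cardinals; thus $\beta(T)$ is the Hilbert dimension of $\mathcal{R}(T)^\perp$ if $\mathcal{R}(T)$ is closed, while if $\mathcal{R}(T)$ is not closed $\beta(T)$ is the algebraic dimension of the quotient, which is infinite. "$=\infty$" means infinite and "$<\infty$" means finite. $\Phi_+(\mathcal{H})=\{T\in\mathcal{B}(\mathcal{H}):\alpha(T)<\infty \text{ and } \mathcal{R}(T)\text{ is closed}\}$; $\Phi_-(\mathcal{H})=\{T\in\mathcal{B}(\mathcal{H}):\beta(T)<\infty\}$;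 $\Phi(\mathcal{H})=\Phi_+(\mathcal{H})\cap\Phi_-(\mathcal{H})=\{T\in\mathcal{B}(\mathcal{H}):\alpha(T)<\infty\text{ and }\beta(T)<\infty\}$. *)

theory Defs
  imports "HOL-Analysis.Analysis" "HOL-Library.Poly_Mapping"
begin

unbundle cardinal_syntax

text \<open>These two constants are hidden by \<^theory>\<open>Main\<close>.\<close>

abbreviation cfinite :: "'a rel \<Rightarrow> bool"
  where "cfinite \<equiv> BNF_Cardinal_Arithmetic.cfinite"

abbreviation cinfinite :: "'a rel \<Rightarrow> bool"
  where "cinfinite \<equiv> BNF_Cardinal_Arithmetic.cinfinite"

section \<open>Complex inner product spaces\<close>

text \<open>
  A complex inner product space is a real one together with a complex scalar multiplication
  extending the real one and a sesquilinear form (linear in the first argument) whose real part is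
  the given real inner product. The norm and topology are those of \<^class>\<open>real_inner\<close>, so
  \<open>norm x = sqrt (Re (cinner x x))\<close>; completeness is deliberately not part of the class.
\<close>

class complex_inner = real_inner +
  fixes scaleC :: "complex \<Rightarrow> 'a \<Rightarrow> 'a" (infixr "*\<^sub>C" 75)
    and cinner :: "'a \<Rightarrow> 'a \<Rightarrow> complex"
  assumes scaleC_add_right: "a *\<^sub>C (x + y) = a *\<^sub>C x + a *\<^sub>C y"
    and scaleC_add_left: "(a + b) *\<^sub>C x = a *\<^sub>C x + b *\<^sub>C x"
    and scaleC_scaleC: "a *\<^sub>C (b *\<^sub>C x) = (a * b) *\<^sub>C x"
    and scaleR_scaleC: "r *\<^sub>R x = complex_of_real r *\<^sub>C x"
    and cinner_commute: "cinner x y = cnj (cinner y x)"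
    and cinner_add_left: "cinner (x + y) z = cinner x z + cinner y z"
    and cinner_scaleC_left: "cinner (a *\<^sub>C x) y = a * cinner x y"
    and inner_eq_Re_cinner: "inner x y = Re (cinner x y)"

lemma scaleC_one: "1 *\<^sub>C x = (x :: 'a::complex_inner)"
  using scaleR_scaleC[of 1 x] by simp

global_interpretation complex_vector:
  vector_space "scaleC :: complex \<Rightarrow> 'a \<Rightarrow> 'a::complex_inner"
  defines csubspace = complex_vector.subspace
    and cspan = complex_vector.span
  by unfold_locales (simp_all add: scaleC_add_right scaleC_add_left scaleC_scaleC scaleC_one)

instantiation complex :: complex_inner
begin

definition scaleC_complex :: "complex \<Rightarrow> complex \<Rightarrow> complex"
  where "scaleC_complex a x = a * x"

definition cinner_complex :: "complex \<Rightarrow> complex \<Rightarrow> complex"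
  where "cinner_complex x y = x * cnj y"

instance
  by standard
    (simp_all add: scaleC_complex_def cinner_complex_def algebra_simps scaleR_conv_of_real
      inner_complex_def)

end

text \<open>
  A Hilbert space is a complete subspace of a complex inner product space; its carrier is a set, so
  that families of different Hilbert spaces can be indexed by natural numbers. Nothing is lost:
  the members of any family of Hilbert spaces embed isometrically, as complete subspaces, in their
  algebraic direct sum.
\<close>

definition hilbert_space :: "'a::complex_inner set \<Rightarrow> bool"
  where "hilbert_space H \<longleftrightarrow> csubspace H \<and> complete H"

text \<open>
  \<open>bounded_ops H K\<close> is \<open>\<B>(H, K)\<close>. Its elements are total functions on the ambient type;
  their values outside \<open>H\<close> are irrelevant and are not used by any notion below.
\<close>

definition bounded_ops ::
  "'a::complex_inner set \<Rightarrow> 'b::complex_inner set \<Rightarrow> ('a \<Rightarrow> 'b) set"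
  where "bounded_ops H K = {T.
    (\<forall>x\<in>H. T x \<in> K) \<and>
    (\<forall>x\<in>H. \<forall>y\<in>H. T (x + y) = T x + T y) \<and>
    (\<forall>c. \<forall>x\<in>H. T (c *\<^sub>C x) = c *\<^sub>C T x) \<and>
    (\<exists>M. \<forall>x\<in>H. norm (T x) \<le> M * norm x)}"


section \<open>Dimensions as cardinals\<close>

definition orthonormal :: "'a::complex_inner set \<Rightarrow> bool"
  where "orthonormal B \<longleftrightarrow>
    (\<forall>x\<in>B. cinner x x = 1) \<and> (\<forall>x\<in>B. \<forall>y\<in>B. x \<noteq> y \<longrightarrow> cinner x y = 0)"

definition orthonormal_basis :: "'a::complex_inner set \<Rightarrow> 'a set \<Rightarrow> bool"
  where "orthonormal_basis V B \<longleftrightarrow> B \<subseteq> V \<and> orthonormal B \<and> V \<subseteq> closure (cspan B)"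

definition hilbert_dim :: "'a::complex_inner set \<Rightarrow> 'a rel"
  where "hilbert_dim V = |SOME B. orthonormal_basis V B|"

text \<open>
  For subspaces \<open>R \<subseteq> H\<close>, \<open>quotient_basis H R B\<close> says that \<open>b \<mapsto> b + R\<close> is injective on \<open>B\<close> and
  maps it onto a Hamel basis of the vector space \<open>H / R\<close>.
\<close>

definition quotient_basis :: "'a::complex_inner set \<Rightarrow> 'a set \<Rightarrow> 'a set \<Rightarrow> bool"
  where "quotient_basis H R B \<longleftrightarrow> B \<subseteq> H \<and>
    (\<forall>F c. finite F \<and> F \<subseteq> B \<and> (\<Sum>b\<in>F. c b *\<^sub>C b) \<in> R \<longrightarrow> (\<forall>b\<in>F. c b = 0)) \<and>
    (\<forall>x\<in>H. \<exists>y\<in>cspan B. x - y \<in> R)"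

definition quotient_dim :: "'a::complex_inner set \<Rightarrow> 'a set \<Rightarrow> 'a rel"
  where "quotient_dim H R = |SOME B. quotient_basis H R B|"

definition orthogonal_complement :: "'a::complex_inner set \<Rightarrow> 'a set \<Rightarrow> 'a set"
  where "orthogonal_complement H R = {x\<in>H. \<forall>y\<in>R. cinner x y = 0}"

definition op_kernel :: "'a::complex_inner set \<Rightarrow> ('a \<Rightarrow> 'a) \<Rightarrow> 'a set"
  where "op_kernel H T = {x\<in>H. T x = 0}"

abbreviation op_range :: "'a::complex_inner set \<Rightarrow> ('a \<Rightarrow> 'a) \<Rightarrow> 'a set"
  where "op_range H T \<equiv> T ` H"

definition alpha :: "'a::complex_inner set \<Rightarrow> ('a \<Rightarrow> 'a) \<Rightarrow> 'a rel"
  where "alpha H T = hilbert_dim (op_kernel H T)"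

text \<open>
  Since \<open>H\<close> is complete, being closed in \<open>H\<close> and being closed in the ambient space coincide
  for subsets of \<open>H\<close>.
\<close>

definition beta :: "'a::complex_inner set \<Rightarrow> ('a \<Rightarrow> 'a) \<Rightarrow> 'a rel"
  where "beta H T =
    (if closed (op_range H T) then hilbert_dim (orthogonal_complement H (op_range H T))
     else quotient_dim H (op_range H T))"


section \<open>Fredholm operators\<close>

definition Phi_plus :: "'a::complex_inner set \<Rightarrow> ('a \<Rightarrow> 'a) set"
  where "Phi_plus H = {T \<in> bounded_ops H H. cfinite (alpha H T) \<and> closed (op_range H T)}"

definition Phi_minus :: "'a::complex_inner set \<Rightarrow> ('a \<Rightarrow> 'a) set"
  where "Phi_minus H = {T \<in> bounded_ops H H. cfinite (beta H T)}"

definition Phi :: "'a::complex_inner set \<Rightarrow> ('a \<Rightarrow> 'a) set"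
  where "Phi H = Phi_plus H \<inter> Phi_minus H"


section \<open>Direct sums\<close>

text \<open>
  Finitely supported families form a complex inner product space under
  \<open>cinner x y = (\<Sum>i. cinner (x i) (y i))\<close>.
\<close>

instantiation poly_mapping :: (type, complex_inner) complex_inner
begin

lift_definition scaleC_poly_mapping :: "complex \<Rightarrow> ('a \<Rightarrow>\<^sub>0 'b) \<Rightarrow> 'a \<Rightarrow>\<^sub>0 'b"
  is "\<lambda>c f i. c *\<^sub>C f i"
  by (erule finite_subset[rotated]) auto

definition scaleR_poly_mapping :: "real \<Rightarrow> ('a \<Rightarrow>\<^sub>0 'b) \<Rightarrow> 'a \<Rightarrow>\<^sub>0 'b"
  where "scaleR_poly_mapping r x = complex_of_real r *\<^sub>C x"

definition cinner_poly_mapping :: "('a \<Rightarrow>\<^sub>0 'b) \<Rightarrow> ('a \<Rightarrow>\<^sub>0 'b) \<Rightarrow> complex"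
  where "cinner_poly_mapping x y =
    (\<Sum>i \<in> Poly_Mapping.keys x. cinner (Poly_Mapping.lookup x i) (Poly_Mapping.lookup y i))"

definition inner_poly_mapping :: "('a \<Rightarrow>\<^sub>0 'b) \<Rightarrow> ('a \<Rightarrow>\<^sub>0 'b) \<Rightarrow> real"
  where "inner_poly_mapping x y = Re (cinner x y)"

definition norm_poly_mapping :: "('a \<Rightarrow>\<^sub>0 'b) \<Rightarrow> real"
  where "norm_poly_mapping x = sqrt (inner x x)"

definition dist_poly_mapping :: "('a \<Rightarrow>\<^sub>0 'b) \<Rightarrow> ('a \<Rightarrow>\<^sub>0 'b) \<Rightarrow> real"
  where "dist_poly_mapping x y = norm (x - y)"

definition sgn_poly_mapping :: "('a \<Rightarrow>\<^sub>0 'b) \<Rightarrow> 'a \<Rightarrow>\<^sub>0 'b"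
  where "sgn_poly_mapping x = inverse (norm x) *\<^sub>R x"

definition uniformity_poly_mapping :: "(('a \<Rightarrow>\<^sub>0 'b) \<times> ('a \<Rightarrow>\<^sub>0 'b)) filter"
  where "uniformity_poly_mapping = (INF e\<in>{0<..}. principal {(x, y). dist x y < e})"

definition open_poly_mapping :: "('a \<Rightarrow>\<^sub>0 'b) set \<Rightarrow> bool"
  where "open_poly_mapping U \<longleftrightarrow>
    (\<forall>x\<in>U. eventually (\<lambda>(x', y). x' = x \<longrightarrow> y \<in> U) uniformity)"

instance
proof
  have zero_left: "cinner 0 v = 0" for v :: 'b
    using cinner_add_left[of 0 0 v] by simp
  have cinner_superset: "cinner x y =
      (\<Sum>i\<in>S. cinner (Poly_Mapping.lookup x i) (Poly_Mapping.lookup y i))"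
    if "finite S" "Poly_Mapping.keys x \<subseteq> S" for x y :: "'a \<Rightarrow>\<^sub>0 'b" and S
    unfolding cinner_poly_mapping_def
    by (rule sum.mono_neutral_left) (use that in \<open>auto simp: in_keys_iff zero_left\<close>)
  have lookup_scaleC: "Poly_Mapping.lookup (c *\<^sub>C x) i = c *\<^sub>C Poly_Mapping.lookup x i"
    for c i and x :: "'a \<Rightarrow>\<^sub>0 'b"
    by transfer simp
  fix x y z :: "'a \<Rightarrow>\<^sub>0 'b" and a b :: complex and r s :: real and U :: "('a \<Rightarrow>\<^sub>0 'b) set"
  let ?S = "Poly_Mapping.keys x \<union> Poly_Mapping.keys y"
  have keys_scaleC: "Poly_Mapping.keys (c *\<^sub>C x) \<subseteq> Poly_Mapping.keys x" for c
    by (auto simp: in_keys_iff lookup_scaleC)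
  show c1: "a *\<^sub>C (x + y) = a *\<^sub>C x + a *\<^sub>C y" for a and x y :: "'a \<Rightarrow>\<^sub>0 'b"
    by (rule poly_mapping_eqI) (simp add: lookup_scaleC lookup_add scaleC_add_right)
  show c2: "(a + b) *\<^sub>C x = a *\<^sub>C x + b *\<^sub>C x" for a b and x :: "'a \<Rightarrow>\<^sub>0 'b"
    by (rule poly_mapping_eqI) (simp add: lookup_scaleC lookup_add scaleC_add_left)
  show c3: "a *\<^sub>C (b *\<^sub>C x) = (a * b) *\<^sub>C x" for a b and x :: "'a \<Rightarrow>\<^sub>0 'b"
    by (rule poly_mapping_eqI) (simp add: lookup_scaleC scaleC_scaleC)
  show "r *\<^sub>R x = complex_of_real r *\<^sub>C x"
    by (rule scaleR_poly_mapping_def)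
  show "r *\<^sub>R (x + y) = r *\<^sub>R x + r *\<^sub>R y"
    by (simp add: scaleR_poly_mapping_def c1)
  show "(r + s) *\<^sub>R x = r *\<^sub>R x + s *\<^sub>R x"
    by (simp add: scaleR_poly_mapping_def c2)
  show "r *\<^sub>R s *\<^sub>R x = (r * s) *\<^sub>R x"
    by (simp add: scaleR_poly_mapping_def c3)
  show "1 *\<^sub>R x = x"
    by (rule poly_mapping_eqI) (simp add: scaleR_poly_mapping_def lookup_scaleC scaleC_one)
  show comm: "cinner x y = cnj (cinner y x)"
  proof -
    have "cinner x y = (\<Sum>i\<in>?S. cinner (Poly_Mapping.lookup x i) (Poly_Mapping.lookup y i))"
      by (rule cinner_superset) auto
    also have "\<dots> = cnj (\<Sum>i\<in>?S. cinner (Poly_Mapping.lookup y i) (Poly_Mapping.lookup x i))"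
      unfolding cnj_sum by (rule sum.cong[OF refl], rule cinner_commute)
    also have "(\<Sum>i\<in>?S. cinner (Poly_Mapping.lookup y i) (Poly_Mapping.lookup x i)) = cinner y x"
      by (rule cinner_superset[symmetric]) auto
    finally show ?thesis .
  qed
  show add: "cinner (x + y) z = cinner x z + cinner y z"
  proof -
    have "cinner (x + y) z =
        (\<Sum>i\<in>?S. cinner (Poly_Mapping.lookup (x + y) i) (Poly_Mapping.lookup z i))"
      by (rule cinner_superset) (auto simp: in_keys_iff lookup_add)
    moreover have "cinner x z =
        (\<Sum>i\<in>?S. cinner (Poly_Mapping.lookup x i) (Poly_Mapping.lookup z i))"
      by (rule cinner_superset) auto
    moreover have "cinner y z =
        (\<Sum>i\<in>?S. cinner (Poly_Mapping.lookup y i) (Poly_Mapping.lookup z i))"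
      by (rule cinner_superset) auto
    ultimately show ?thesis
      by (simp add: lookup_add cinner_add_left sum.distrib)
  qed
  show scale: "cinner (a *\<^sub>C x) y = a * cinner x y" for a
    unfolding cinner_superset[OF finite_keys keys_scaleC]
    by (simp add: cinner_poly_mapping_def lookup_scaleC cinner_scaleC_left sum_distrib_left)
  show "inner x y = Re (cinner x y)"
    by (rule inner_poly_mapping_def)
  show "inner x y = inner y x"
    unfolding inner_poly_mapping_def by (simp add: comm)
  show "inner (x + y) z = inner x z + inner y z"
    unfolding inner_poly_mapping_def by (simp add: add)
  show "inner (r *\<^sub>R x) y = r * inner x y"
    unfolding inner_poly_mapping_def scaleR_poly_mapping_def by (simp add: scale)
  have inner_self: "inner x x =
      (\<Sum>i\<in>Poly_Mapping.keys x. inner (Poly_Mapping.lookup x i) (Poly_Mapping.lookup x i))"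
    by (simp add: inner_poly_mapping_def cinner_poly_mapping_def inner_eq_Re_cinner)
  show "0 \<le> inner x x"
    unfolding inner_self by (rule sum_nonneg) simp
  show "inner x x = 0 \<longleftrightarrow> x = 0"
    unfolding inner_self
    by (subst sum_nonneg_eq_0_iff) (auto simp: in_keys_iff intro!: poly_mapping_eqI)
  show "norm x = sqrt (inner x x)"
    by (rule norm_poly_mapping_def)
  show "dist x y = norm (x - y)"
    by (rule dist_poly_mapping_def)
  show "sgn x = inverse (norm x) *\<^sub>R x"
    by (rule sgn_poly_mapping_def)
  show "uniformity = (INF e\<in>{0<..}. principal {(x :: 'a \<Rightarrow>\<^sub>0 'b, y). dist x y < e})"
    by (rule uniformity_poly_mapping_def)
  show "open U \<longleftrightarrow> (\<forall>x\<in>U. eventually (\<lambda>(x', y). x' = x \<longrightarrow> y \<in> U) uniformity)"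
    by (rule open_poly_mapping_def)
qed

end

text \<open>The external direct sum \<open>H 1 \<oplus> \<dots> \<oplus> H n\<close>.\<close>

definition direct_sum :: "nat \<Rightarrow> (nat \<Rightarrow> 'a::complex_inner set) \<Rightarrow> (nat \<Rightarrow>\<^sub>0 'a) set"
  where "direct_sum n H = {x.
    (\<forall>i\<in>{1..n}. Poly_Mapping.lookup x i \<in> H i) \<and>
    (\<forall>i. i \<notin> {1..n} \<longrightarrow> Poly_Mapping.lookup x i = 0)}"

text \<open>
  \<open>\<B>\<^sub>n\<close>: a tuple is a doubly indexed family of which only the entries with
  \<open>1 \<le> i < j \<le> n\<close> matter.
\<close>

definition upper_tuples ::
  "nat \<Rightarrow> (nat \<Rightarrow> 'a::complex_inner set) \<Rightarrow> (nat \<Rightarrow> nat \<Rightarrow> 'a \<Rightarrow> 'a) set"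
  where "upper_tuples n H =
    {A. \<forall>i j. 1 \<le> i \<and> i < j \<and> j \<le> n \<longrightarrow> A i j \<in> bounded_ops (H j) (H i)}"

definition block_entry ::
  "(nat \<Rightarrow> 'a \<Rightarrow> 'a) \<Rightarrow> (nat \<Rightarrow> nat \<Rightarrow> 'a \<Rightarrow> 'a) \<Rightarrow> nat \<Rightarrow> nat \<Rightarrow> 'a \<Rightarrow> 'a::complex_inner"
  where "block_entry D A i j = (if i = j then D i else if i < j then A i j else (\<lambda>_. 0))"

lift_definition block_operator ::
  "nat \<Rightarrow> (nat \<Rightarrow> 'a \<Rightarrow> 'a) \<Rightarrow> (nat \<Rightarrow> nat \<Rightarrow> 'a \<Rightarrow> 'a) \<Rightarrow> (nat \<Rightarrow>\<^sub>0 'a) \<Rightarrow> (nat \<Rightarrow>\<^sub>0 'a::complex_inner)"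
  is "\<lambda>n D A x i. if i \<in> {1..n} then \<Sum>j\<in>{1..n}. block_entry D A i j (x j) else 0"
  by (rule finite_subset[of _ "{1..n}" for n]) auto

end

theory Submission
  imports Defs
begin

text \<open>
Whether \<open>T\<close> is Fredholm is a purely algebraic matter: the kernel and the quotient by the range have
to be finite-dimensional. The range is then closed automatically, by the open mapping theorem
(\<open>closed_op_range_of_finite_codim\<close>). Together with \<open>cfinite_alpha_iff\<close> and \<open>cfinite_beta_iff\<close>
this turns every finiteness condition on \<open>\<alpha>\<close> and \<open>\<beta>\<close> into a statement about one relation
\<open>finite_over V W\<close>, which says that \<open>V\<close> is finite-dimensional modulo \<open>W\<close>; it passes along
preimages, images and compositions like the dimension inequalities it replaces.

For the implication from (ii) to (iii), let \<open>T\<close> be an upper triangular Fredholm operator. If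
\<open>\<beta>(D\<^sub>i)\<close> is finite for all \<open>i < s\<close>, back substitution shows that the leading \<open>(s-1) \<times> (s-1)\<close> corner
has range of finite codimension. Up to finitely many dimensions, every vector of the kernel of \<open>D\<^sub>s\<close>
can hence be completed to a vector of the kernel of \<open>T\<close>, so \<open>\<alpha>(D\<^sub>s)\<close> is finite
(\<open>finite_dim_kernel_D\<close>). Dually, if \<open>\<alpha>(D\<^sub>i)\<close> is finite for all \<open>i > s\<close>, then \<open>\<beta>(D\<^sub>s)\<close> is finite
(\<open>finite_codim_range_D\<close>). Now let \<open>j\<close> be the least index below \<open>n\<close> with \<open>\<beta>(D\<^sub>j)\<close> infinite and \<open>k\<close>
the greatest index above \<open>1\<close> with \<open>\<alpha>(D\<^sub>k)\<close> infinite. The two facts give the finiteness conditions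
around \<open>j\<close> and \<open>k\<close>, and \<open>j < k\<close> because \<open>\<alpha>(D\<^sub>s)\<close> is finite for all \<open>s \<le> j\<close>. If there is no such
\<open>j\<close>, all diagonal entries are Fredholm; if there is no such \<open>k\<close>, there is no such \<open>j\<close> either. The one
topological assertion left, that \<open>D\<^sub>1\<close> has closed range, is obtained by restricting \<open>T\<close> to the sum of
the first summand and the kernel of \<open>T\<close> (\<open>closed_range_D1\<close>).

For the implication from (i) to (ii), the choice \<open>A = 0\<close> works when all diagonal entries have finite
\<open>\<alpha>\<close> and \<open>\<beta>\<close>, and this covers every case except \<open>\<alpha>(D\<^sub>s) = \<beta>(D\<^sub>s\<^sub>-\<^sub>1)\<close> for all \<open>s\<close>. In that case a
bijection of orthonormal bases gives a partial isometry from \<open>H\<^sub>s\<close> to \<open>H\<^sub>s\<^sub>-\<^sub>1\<close> which maps the kernel of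
\<open>D\<^sub>s\<close> onto the orthogonal complement of the range of \<open>D\<^sub>s\<^sub>-\<^sub>1\<close> (\<open>partial_isometry_exists\<close>). Put on the
superdiagonal, these operators cancel all inner kernels against all inner cokernels, and only the
kernel of \<open>D\<^sub>1\<close> and the cokernel of \<open>D\<^sub>n\<close> survive (\<open>staircase_completion\<close>).
\<close>

section \<open>Linear maps on subspaces and finite codimension\<close>

definition clinear_on :: "'a::complex_inner set \<Rightarrow> ('a \<Rightarrow> 'b::complex_inner) \<Rightarrow> bool"
  where "clinear_on V f \<longleftrightarrow>
    (\<forall>x\<in>V. \<forall>y\<in>V. f (x + y) = f x + f y) \<and> (\<forall>c. \<forall>x\<in>V. f (c *\<^sub>C x) = c *\<^sub>C f x)"

lemma clinear_onI:
  assumes "\<And>x y. x \<in> V \<Longrightarrow> y \<in> V \<Longrightarrow> f (x + y) = f x + f y"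
    and "\<And>c x. x \<in> V \<Longrightarrow> f (c *\<^sub>C x) = c *\<^sub>C f x"
  shows "clinear_on V f"
  using assms unfolding clinear_on_def by blast

lemma clinear_on_subset: "clinear_on V f \<Longrightarrow> W \<subseteq> V \<Longrightarrow> clinear_on W f"
  unfolding clinear_on_def by blast

context
  fixes V :: "'a::complex_inner set" and f :: "'a \<Rightarrow> 'b::complex_inner"
  assumes V: "csubspace V" and f: "clinear_on V f"
begin

lemma clinear_on_add: "x \<in> V \<Longrightarrow> y \<in> V \<Longrightarrow> f (x + y) = f x + f y"
  using f unfolding clinear_on_def by blast

lemma clinear_on_scaleC: "x \<in> V \<Longrightarrow> f (c *\<^sub>C x) = c *\<^sub>C f x"
  using f unfolding clinear_on_def by blast

lemma clinear_on_zero: "f 0 = 0"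
  using clinear_on_scaleC[of 0 0] complex_vector.subspace_0[OF V] by simp

lemma clinear_on_diff: "x \<in> V \<Longrightarrow> y \<in> V \<Longrightarrow> f (x - y) = f x - f y"
  using clinear_on_add[of "x - y" y] complex_vector.subspace_diff[OF V, of x y] by simp

lemma csubspace_image: "csubspace (f ` V)"
proof (rule complex_vector.subspaceI)
  show "0 \<in> f ` V"
    using clinear_on_zero complex_vector.subspace_0[OF V] by force
next
  fix x y assume "x \<in> f ` V" "y \<in> f ` V"
  then show "x + y \<in> f ` V"
    using complex_vector.subspace_add[OF V] by (auto simp: clinear_on_add[symmetric])
next
  fix c x assume "x \<in> f ` V"
  then show "c *\<^sub>C x \<in> f ` V"
    using complex_vector.subspace_scale[OF V] by (auto simp: clinear_on_scaleC[symmetric])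
qed

lemma csubspace_vimage:
  assumes R: "csubspace R"
  shows "csubspace {x \<in> V. f x \<in> R}"
proof (rule complex_vector.subspaceI)
  show "0 \<in> {x \<in> V. f x \<in> R}"
    using clinear_on_zero complex_vector.subspace_0[OF V] complex_vector.subspace_0[OF R] by simp
next
  fix x y assume "x \<in> {x \<in> V. f x \<in> R}" "y \<in> {x \<in> V. f x \<in> R}"
  then show "x + y \<in> {x \<in> V. f x \<in> R}"
    using clinear_on_add complex_vector.subspace_add[OF V] complex_vector.subspace_add[OF R] by simp
next
  fix c x assume "x \<in> {x \<in> V. f x \<in> R}"
  then show "c *\<^sub>C x \<in> {x \<in> V. f x \<in> R}"
    using clinear_on_scaleC complex_vector.subspace_scale[OF V] complex_vector.subspace_scale[OF R]
    by simp
qed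

lemma clinear_on_cspan:
  assumes "S \<subseteq> V" "y \<in> cspan S"
  shows "y \<in> V \<and> f y \<in> cspan (f ` S)"
  using assms(2)
proof (induction rule: complex_vector.span_induct_alt)
  case base
  show ?case
    using clinear_on_zero complex_vector.subspace_0[OF V] complex_vector.span_zero by simp
next
  case (step c x y)
  then have x: "x \<in> V" using assms by blast
  have "f (c *\<^sub>C x + y) = c *\<^sub>C f x + f y"
    using x step complex_vector.subspace_scale[OF V] clinear_on_add clinear_on_scaleC by simp
  moreover have "c *\<^sub>C f x + f y \<in> cspan (f ` S)"
    using step by (intro complex_vector.span_add complex_vector.span_scale)
      (auto intro: complex_vector.span_base)
  ultimately show ?case
    using x step complex_vector.subspace_scale[OF V] complex_vector.subspace_add[OF V] by simp
qed

end

text \<open>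
The quotient \<open>(V + W) / W\<close> is finite-dimensional. No inclusion between \<open>V\<close> and \<open>W\<close> is built in, so
that \<open>W\<close> can be the range of an operator and \<open>V\<close> a set that only partly lies in it. The spanning set
is taken inside \<open>V\<close> because the maps applied to it are linear on \<open>V\<close> only.
\<close>

definition finite_over :: "'a::complex_inner set \<Rightarrow> 'a set \<Rightarrow> bool"
  where "finite_over V W \<longleftrightarrow> (\<exists>S. finite S \<and> S \<subseteq> V \<and> (\<forall>x\<in>V. \<exists>y\<in>cspan S. x - y \<in> W))"

abbreviation finite_dim :: "'a::complex_inner set \<Rightarrow> bool"
  where "finite_dim V \<equiv> finite_over V {0}"

lemma finite_over_mono: "finite_over V W \<Longrightarrow> W \<subseteq> W' \<Longrightarrow> finite_over V W'"
  unfolding finite_over_def by (meson subsetD)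

lemma finite_over_self: "V \<subseteq> W \<Longrightarrow> finite_over V W"
  unfolding finite_over_def
  by (rule exI[of _ "{}"]) auto

lemma finite_over_trans:
  assumes VW: "finite_over V W" and WU: "finite_over W U" and sub: "W \<subseteq> V"
  shows "finite_over V U"
proof -
  obtain S where S: "finite S" "S \<subseteq> V" "\<forall>x\<in>V. \<exists>y\<in>cspan S. x - y \<in> W"
    using VW unfolding finite_over_def by blast
  obtain S' where S': "finite S'" "S' \<subseteq> W" "\<forall>x\<in>W. \<exists>y\<in>cspan S'. x - y \<in> U"
    using WU unfolding finite_over_def by blast
  have "\<exists>y\<in>cspan (S \<union> S'). x - y \<in> U" if x: "x \<in> V" for x
  proof -
    obtain y where y: "y \<in> cspan S" "x - y \<in> W" using bspec[OF S(3) x] by auto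
    obtain z where z: "z \<in> cspan S'" "x - y - z \<in> U" using bspec[OF S'(3) y(2)] by auto
    have "y + z \<in> cspan (S \<union> S')"
      using y z complex_vector.span_mono[of S "S \<union> S'"] complex_vector.span_mono[of S' "S \<union> S'"]
      by (intro complex_vector.span_add) auto
    moreover have "x - (y + z) \<in> U" using z by (simp add: algebra_simps)
    ultimately show ?thesis by blast
  qed
  then show ?thesis
    unfolding finite_over_def using S S' sub by (intro exI[of _ "S \<union> S'"]) auto
qed

text \<open>
Induction on the spanning set. With \<open>R' = R + \<complex> b\<close>, the induction hypothesis compares \<open>V\<close> with the
preimage of \<open>R'\<close>, and the preimage of \<open>R\<close> has codimension at most one in that of \<open>R'\<close>: a single
vector \<open>x0\<close> that is sent into \<open>R'\<close> but not into \<open>R\<close> spans the difference.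
\<close>

lemma finite_over_vimage_cspan:
  assumes "finite S" and "csubspace V" and "clinear_on V f" and "csubspace R"
    and "\<forall>x\<in>V. \<exists>y\<in>cspan S. f x - y \<in> R"
  shows "finite_over V {x \<in> V. f x \<in> R}"
  using assms
proof (induction S arbitrary: R rule: finite_induct)
  case empty
  then show ?case by (intro finite_over_self) auto
next
  case (insert b S)
  note V = \<open>csubspace V\<close> and f = \<open>clinear_on V f\<close> and R = \<open>csubspace R\<close>
  define R' where "R' = {r + c *\<^sub>C b | r c. r \<in> R}"
  have R': "csubspace R'"
  proof (rule complex_vector.subspaceI)
    have "0 = 0 + 0 *\<^sub>C b" by simp
    then show "0 \<in> R'" unfolding R'_def using complex_vector.subspace_0[OF R] by blast
  next
    fix x y assume "x \<in> R'" "y \<in> R'"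
    then obtain r c s d where "x = r + c *\<^sub>C b" "y = s + d *\<^sub>C b" "r \<in> R" "s \<in> R"
      unfolding R'_def by blast
    then have "x + y = (r + s) + (c + d) *\<^sub>C b" "r + s \<in> R"
      using complex_vector.subspace_add[OF R] by (auto simp: scaleC_add_left)
    then show "x + y \<in> R'" unfolding R'_def by blast
  next
    fix k x assume "x \<in> R'"
    then obtain r c where "x = r + c *\<^sub>C b" "r \<in> R"
      unfolding R'_def by blast
    then have "k *\<^sub>C x = k *\<^sub>C r + (k * c) *\<^sub>C b" "k *\<^sub>C r \<in> R"
      using complex_vector.subspace_scale[OF R] by (auto simp: scaleC_add_right scaleC_scaleC)
    then show "k *\<^sub>C x \<in> R'" unfolding R'_def by blast
  qed
  have "R \<subseteq> R'"
    unfolding R'_def by (auto intro!: exI[of _ "0::complex"])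
  have "\<forall>x\<in>V. \<exists>y\<in>cspan S. f x - y \<in> R'"
  proof
    fix x assume "x \<in> V"
    then obtain y where y: "y \<in> cspan (insert b S)" "f x - y \<in> R" using insert.prems(4) by auto
    \<comment> \<open>The multiple of \<open>b\<close> in \<open>y\<close> is absorbed by \<open>R'\<close>.\<close>
    then obtain k where k: "y - k *\<^sub>C b \<in> cspan S"
      by (metis complex_vector.span_breakdown_eq)
    have "f x - (y - k *\<^sub>C b) = (f x - y) + k *\<^sub>C b" by simp
    then have "f x - (y - k *\<^sub>C b) \<in> R'" using y unfolding R'_def by blast
    then show "\<exists>y\<in>cspan S. f x - y \<in> R'" using k by blast
  qed
  then have fin: "finite_over V {x \<in> V. f x \<in> R'}"
    using insert.IH[OF V f R'] by blast
  have "finite_over {x \<in> V. f x \<in> R'} {x \<in> V. f x \<in> R}"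
  proof (cases "\<forall>x\<in>V. f x \<in> R' \<longrightarrow> f x \<in> R")
    case True
    then show ?thesis by (intro finite_over_self) auto
  next
    case False
    then obtain x0 where x0: "x0 \<in> V" "f x0 \<in> R'" "f x0 \<notin> R" by blast
    then obtain r0 c0 where r0: "f x0 = r0 + c0 *\<^sub>C b" "r0 \<in> R" unfolding R'_def by blast
    then have c0: "c0 \<noteq> 0" using x0 by auto
    have "\<exists>y\<in>cspan {x0}. x - y \<in> {x \<in> V. f x \<in> R}" if x: "x \<in> V" "f x \<in> R'" for x
    proof -
      obtain r c where r: "f x = r + c *\<^sub>C b" "r \<in> R" using x unfolding R'_def by blast
      have "f (x - (c / c0) *\<^sub>C x0) = f x - (c / c0) *\<^sub>C f x0"
        using x x0 complex_vector.subspace_scale[OF V]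
        by (simp add: clinear_on_diff[OF V f] clinear_on_scaleC[OF V f])
      also have "\<dots> = r - (c / c0) *\<^sub>C r0"
        using c0 by (simp add: r r0 scaleC_add_right scaleC_scaleC)
      also have "\<dots> \<in> R"
        using r r0 complex_vector.subspace_scale[OF R] complex_vector.subspace_diff[OF R] by blast
      finally have "x - (c / c0) *\<^sub>C x0 \<in> {x \<in> V. f x \<in> R}"
        using x x0 complex_vector.subspace_scale[OF V] complex_vector.subspace_diff[OF V] by simp
      moreover have "(c / c0) *\<^sub>C x0 \<in> cspan {x0}"
        by (intro complex_vector.span_scale complex_vector.span_base) simp
      ultimately show ?thesis by blast
    qed
    then show ?thesis
      unfolding finite_over_def using x0 by (intro exI[of _ "{x0}"]) auto
  qed
  moreover have "{x \<in> V. f x \<in> R} \<subseteq> {x \<in> V. f x \<in> R'}" using \<open>R \<subseteq> R'\<close> by blast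
  ultimately show ?case
    by (intro finite_over_trans[OF fin]) auto
qed

text \<open>
The workhorse of the algebraic part: \<open>V / f\<^sup>-\<^sup>1(R)\<close> embeds into \<open>U / R\<close>.
\<close>

lemma finite_over_vimage:
  assumes "csubspace V" "clinear_on V f" "csubspace R" "finite_over U R" "f ` V \<subseteq> U"
  shows "finite_over V {x \<in> V. f x \<in> R}"
proof -
  obtain S where S: "finite S" "\<forall>x\<in>U. \<exists>y\<in>cspan S. x - y \<in> R"
    using assms unfolding finite_over_def by blast
  show ?thesis
    by (rule finite_over_vimage_cspan[OF S(1)]) (use assms S in auto)
qed

lemma finite_over_image:
  assumes V: "csubspace V" and f: "clinear_on V f" and fin: "finite_over V W" and "W \<subseteq> V"
  shows "finite_over (f ` V) (f ` W)"
proof -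
  obtain S where S: "finite S" "S \<subseteq> V" "\<forall>x\<in>V. \<exists>y\<in>cspan S. x - y \<in> W"
    using fin unfolding finite_over_def by blast
  have "\<exists>y\<in>cspan (f ` S). f x - y \<in> f ` W" if x: "x \<in> V" for x
  proof -
    obtain y where y: "y \<in> cspan S" "x - y \<in> W" using bspec[OF S(3) x] by auto
    have yV: "y \<in> V" "f y \<in> cspan (f ` S)" using clinear_on_cspan[OF V f S(2) y(1)] by auto
    have "f x - f y \<in> f ` W" using y clinear_on_diff[OF V f x yV(1)] by (metis imageI)
    then show ?thesis using yV by blast
  qed
  then show ?thesis
    unfolding finite_over_def using S by (intro exI[of _ "f ` S"]) auto
qed

lemma finite_over_subspace:
  assumes V: "csubspace V" and W: "csubspace W" and fin: "finite_over U W" and "V \<subseteq> U"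
  shows "finite_over V (V \<inter> W)"
proof -
  have "finite_over V {x \<in> V. x \<in> W}"
    by (rule finite_over_vimage[of V "\<lambda>x. x" W U])
      (use assms in \<open>auto simp: clinear_on_def\<close>)
  moreover have "{x \<in> V. x \<in> W} = V \<inter> W" by blast
  ultimately show ?thesis by simp
qed

lemma finite_dim_subspace:
  assumes "finite_dim U" "csubspace V" "V \<subseteq> U"
  shows "finite_dim V"
  by (rule finite_over_mono[OF finite_over_subspace[OF assms(2) _ assms(1,3)]])
    (auto intro: complex_vector.subspace_single_0)

lemma finite_dim_iff: "csubspace V \<Longrightarrow> finite_dim V \<longleftrightarrow> (\<exists>S. finite S \<and> S \<subseteq> V \<and> V \<subseteq> cspan S)"
  unfolding finite_over_def by auto

lemma finite_dim_cspan: "finite S \<Longrightarrow> finite_dim (cspan S)"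
  using complex_vector.span_superset by (subst finite_dim_iff) (auto simp: complex_vector.subspace_span)

lemma finite_over_sum:
  assumes "csubspace V" "csubspace W" "finite_over V W"
  shows "finite_over {v + w | v w. v \<in> V \<and> w \<in> W} W"
proof -
  obtain S where S: "finite S" "S \<subseteq> V" "\<forall>x\<in>V. \<exists>y\<in>cspan S. x - y \<in> W"
    using assms(3) unfolding finite_over_def by blast
  have "\<exists>y\<in>cspan S. v + w - y \<in> W" if vw: "v \<in> V" "w \<in> W" for v w
  proof -
    obtain y where "y \<in> cspan S" "v - y \<in> W" using bspec[OF S(3) vw(1)] by auto
    moreover have "v + w - y = (v - y) + w" by simp
    ultimately show ?thesis using complex_vector.subspace_add[OF assms(2)] vw by metis
  qed
  moreover have "S \<subseteq> {v + w | v w. v \<in> V \<and> w \<in> W}"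
    using S complex_vector.subspace_0[OF assms(2)] by force
  ultimately show ?thesis
    unfolding finite_over_def using S by (intro exI[of _ S]) auto
qed

section \<open>Orthogonality and orthonormal bases\<close>

lemma cinner_add_right: "cinner x (y + z) = cinner x y + cinner x z"
  by (metis cinner_add_left cinner_commute complex_cnj_add)

lemma cinner_scaleC_right: "cinner x (a *\<^sub>C y) = cnj a * cinner x y"
  by (metis cinner_commute cinner_scaleC_left complex_cnj_mult)

lemma cinner_zero_left [simp]: "cinner 0 y = 0"
  using cinner_add_left[of 0 0 y] by simp

lemma cinner_zero_right [simp]: "cinner x 0 = 0"
  using cinner_add_right[of x 0 0] by simp

lemma cinner_diff_left: "cinner (x - y) z = cinner x z - cinner y z"
  using cinner_add_left[of "x - y" y z] by simp

lemma cinner_sum_left: "cinner (sum f A) y = (\<Sum>i\<in>A. cinner (f i) y)"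
  by (induction A rule: infinite_finite_induct) (auto simp: cinner_add_left)

lemma cinner_self: "cinner x x = complex_of_real ((norm x)\<^sup>2)"
proof -
  have "Im (cinner x x) = 0"
    using arg_cong[OF cinner_commute[of x x], of Im] by simp
  moreover have "Re (cinner x x) = (norm x)\<^sup>2"
    by (simp add: power2_norm_eq_inner inner_eq_Re_cinner)
  ultimately show ?thesis by (simp add: complex_eq_iff)
qed

lemma cinner_self_eq_0 [simp]: "cinner x x = 0 \<longleftrightarrow> x = 0"
  by (simp add: cinner_self)

lemma cinner_eq_0_commute: "cinner x y = 0 \<longleftrightarrow> cinner y x = 0"
  by (metis cinner_commute complex_cnj_zero)

lemma norm_scaleC: "norm (c *\<^sub>C x) = cmod c * norm x"
proof -
  have "complex_of_real ((norm (c *\<^sub>C x))\<^sup>2) = c * cnj c * cinner x x"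
    by (simp only: cinner_self[symmetric] cinner_scaleC_left cinner_scaleC_right ac_simps)
  also have "\<dots> = complex_of_real ((cmod c * norm x)\<^sup>2)"
    by (simp only: cinner_self complex_norm_square[symmetric] power_mult_distrib of_real_mult)
  finally have "(norm (c *\<^sub>C x))\<^sup>2 = (cmod c * norm x)\<^sup>2"
    by (simp only: of_real_eq_iff)
  then show ?thesis by (simp add: power2_eq_iff_nonneg)
qed

lemma norm_cinner_le: "cmod (cinner x y) \<le> norm x * norm y"
proof (cases "cinner x y = 0")
  case False
  define u where "u = cnj (sgn (cinner x y))"
  have u: "cmod u = 1" using False by (simp add: u_def norm_sgn)
  have "u * cinner x y = complex_of_real (cmod (cinner x y))"
    by (simp add: u_def sgn_eq complex_norm_square[symmetric] mult.commute power2_eq_square)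
  then have "cmod (cinner x y) = inner (u *\<^sub>C x) y"
    by (simp add: inner_eq_Re_cinner cinner_scaleC_left)
  also have "\<dots> \<le> norm (u *\<^sub>C x) * norm y" by (rule norm_cauchy_schwarz)
  finally show ?thesis by (simp add: norm_scaleC u)
qed simp

lemma cinner_scaleR_left: "cinner (r *\<^sub>R x) y = complex_of_real r * cinner x y"
  by (simp add: scaleR_scaleC cinner_scaleC_left)

lemma bounded_linear_scaleC_left: "bounded_linear (\<lambda>c. c *\<^sub>C x)"
proof (rule bounded_linear_intro[of _ "norm x"])
  show "(r *\<^sub>R c) *\<^sub>C x = r *\<^sub>R (c *\<^sub>C x)" for r :: real and c :: complex
    by (simp only: scaleR_conv_of_real scaleR_scaleC[of r "c *\<^sub>C x"] scaleC_scaleC)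
qed (simp_all add: scaleC_add_left norm_scaleC)

lemmas tendsto_scaleC_left = bounded_linear.tendsto[OF bounded_linear_scaleC_left]

lemma bounded_linear_cinner_left: "bounded_linear (\<lambda>x. cinner x y)"
  by (rule bounded_linear_intro[of _ "norm y"])
    (auto simp: cinner_add_left cinner_scaleR_left scaleR_conv_of_real norm_cinner_le)

lemmas tendsto_cinner_left = bounded_linear.tendsto[OF bounded_linear_cinner_left]

lemma closure_sequenceE:
  fixes S :: "'a::metric_space set"
  assumes "x \<in> closure S"
  obtains y where "\<And>k. y k \<in> S" "y \<longlonglongrightarrow> x"
  using assms unfolding closure_sequential by auto

lemma csubspace_scaleR: "csubspace V \<Longrightarrow> x \<in> V \<Longrightarrow> r *\<^sub>R x \<in> V"
  by (simp add: scaleR_scaleC complex_vector.subspace_scale)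

lemma norm_add_orthogonal: "cinner x y = 0 \<Longrightarrow> (norm (x + y))\<^sup>2 = (norm x)\<^sup>2 + (norm y)\<^sup>2"
  using cinner_eq_0_commute[of x y]
  by (simp add: power2_norm_eq_inner inner_eq_Re_cinner cinner_add_left cinner_add_right)

text \<open>
Moving \<open>p\<close> to \<open>p + t w\<close> cannot decrease the distance to \<open>x\<close>. At the minimising value of \<open>t\<close> this
forces the real part of the inner product to vanish; applying it to \<open>\<i> w\<close> gives the imaginary part.
\<close>

lemma closest_point_orthogonal:
  assumes W: "csubspace W" and p: "p \<in> W" and le: "\<And>w. w \<in> W \<Longrightarrow> norm (x - p) \<le> norm (x - w)"
    and w: "w \<in> W"
  shows "cinner (x - p) w = 0"
proof -
  have re: "inner (x - p) w = 0" if w: "w \<in> W" for w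
  proof (rule ccontr)
    assume ne: "inner (x - p) w \<noteq> 0"
    then have n: "(norm w)\<^sup>2 > 0" by auto
    define t where "t = inner (x - p) w / (norm w)\<^sup>2"
    have "p + t *\<^sub>R w \<in> W"
      using p w by (simp add: W csubspace_scaleR complex_vector.subspace_add)
    then have "(norm (x - p))\<^sup>2 \<le> (norm ((x - p) - t *\<^sub>R w))\<^sup>2"
      using le[of "p + t *\<^sub>R w"] by (simp add: diff_diff_eq)
    also have "\<dots> = (norm (x - p))\<^sup>2 - 2 * t * inner (x - p) w + t\<^sup>2 * (norm w)\<^sup>2"
      unfolding power2_norm_eq_inner
      by (simp add: inner_diff_left inner_diff_right inner_commute power2_eq_square algebra_simps)
    also have "\<dots> = (norm (x - p))\<^sup>2 - (inner (x - p) w)\<^sup>2 / (norm w)\<^sup>2"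
      using n by (simp add: t_def power2_eq_square field_simps)
    finally have "(inner (x - p) w)\<^sup>2 / (norm w)\<^sup>2 \<le> 0" by simp
    moreover have "(inner (x - p) w)\<^sup>2 / (norm w)\<^sup>2 > 0" using ne n by simp
    ultimately show False by simp
  qed
  have "\<i> *\<^sub>C w \<in> W" using w W by (simp add: complex_vector.subspace_scale)
  then have "Re (cinner (x - p) (\<i> *\<^sub>C w)) = 0" using re inner_eq_Re_cinner by metis
  then have "Im (cinner (x - p) w) = 0" by (simp add: cinner_scaleC_right)
  moreover have "Re (cinner (x - p) w) = 0" using re[OF w] by (simp add: inner_eq_Re_cinner)
  ultimately show ?thesis by (simp add: complex_eq_iff)
qed

text \<open>
By the parallelogram law a sequence in \<open>W\<close> that minimises the distance to \<open>x\<close> is Cauchy. Its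
limit exists by completeness of \<open>W\<close>.
\<close>

lemma orthogonal_projection_exists:
  assumes W: "csubspace W" and cW: "complete W"
  obtains p where "p \<in> W" "\<And>w. w \<in> W \<Longrightarrow> cinner (x - p) w = 0"
proof -
  have W0: "0 \<in> W" using W by (rule complex_vector.subspace_0)
  define D where "D = (INF w\<in>W. (norm (x - w))\<^sup>2)"
  have bdd: "bdd_below ((\<lambda>w. (norm (x - w))\<^sup>2) ` W)"
    by (intro bdd_belowI[of _ 0]) auto
  have D: "D \<le> (norm (x - w))\<^sup>2" if "w \<in> W" for w
    unfolding D_def using bdd that by (rule cINF_lower)
  have "\<exists>w\<in>W. (norm (x - w))\<^sup>2 < D + inverse (real (Suc k))" for k
    using cINF_less_iff[OF _ bdd, of "D + inverse (real (Suc k))"] W0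
    unfolding D_def[symmetric] by force
  then obtain w where w: "\<And>k. w k \<in> W" "\<And>k. (norm (x - w k))\<^sup>2 < D + inverse (real (Suc k))"
    by metis
  have par: "(norm (w m - w k))\<^sup>2 \<le> 2 * inverse (real (Suc m)) + 2 * inverse (real (Suc k))" for m k
  proof -
    define c where "c = (1/2) *\<^sub>R (w m + w k)"
    have "c \<in> W" unfolding c_def
      using w W by (simp add: csubspace_scaleR complex_vector.subspace_add)
    have "(norm (w m - w k))\<^sup>2 = 2 * (norm (x - w m))\<^sup>2 + 2 * (norm (x - w k))\<^sup>2 - 4 * (norm (x - c))\<^sup>2"
      unfolding c_def
      by (simp add: power2_norm_eq_inner inner_diff inner_add inner_commute algebra_simps)
    then show ?thesis using D[OF \<open>c \<in> W\<close>] w(2)[of m] w(2)[of k] by linarith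
  qed
  have "Cauchy w"
  proof (rule metric_CauchyI)
    fix e :: real assume "e > 0"
    then obtain N where N: "inverse (real (Suc N)) < e\<^sup>2 / 4"
      using reals_Archimedean[of "e\<^sup>2 / 4"] by auto
    have "dist (w m) (w k) < e" if "m \<ge> N" "k \<ge> N" for m k
    proof -
      have "inverse (real (Suc m)) \<le> inverse (real (Suc N))" "inverse (real (Suc k)) \<le> inverse (real (Suc N))"
        using that by (auto intro!: le_imp_inverse_le)
      then have "(norm (w m - w k))\<^sup>2 < e\<^sup>2" using par[of m k] N by linarith
      then show ?thesis using \<open>e > 0\<close> by (simp add: dist_norm power_less_imp_less_base)
    qed
    then show "\<exists>M. \<forall>m\<ge>M. \<forall>n\<ge>M. dist (w m) (w n) < e" by blast
  qed
  then obtain p where p: "p \<in> W" "w \<longlonglongrightarrow> p"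
    using cW w(1) unfolding complete_def by blast
  have "(norm (x - p))\<^sup>2 \<le> D"
  proof (rule LIMSEQ_le)
    show "(\<lambda>k. (norm (x - w k))\<^sup>2) \<longlonglongrightarrow> (norm (x - p))\<^sup>2" by (intro tendsto_intros p)
    show "(\<lambda>k. D + inverse (real (Suc k))) \<longlonglongrightarrow> D"
      using tendsto_add[OF tendsto_const[of D] LIMSEQ_inverse_real_of_nat] by simp
    show "\<exists>N. \<forall>k\<ge>N. (norm (x - w k))\<^sup>2 \<le> D + inverse (real (Suc k))"
      using w(2) less_imp_le by blast
  qed
  then have "norm (x - p) \<le> norm (x - u)" if "u \<in> W" for u
    using D[OF that] by (meson norm_ge_zero order_trans power2_le_imp_le)
  then show thesis using that p(1) closest_point_orthogonal[OF W p(1)] by blast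
qed

text \<open>
Zorn's lemma; a nonzero vector orthogonal to a maximal orthonormal set could be normalised and added
to it. The set yields orthonormal bases both of finite-dimensional subspaces and of complete ones.
\<close>

lemma maximal_orthonormal_exists:
  assumes V: "csubspace V"
  obtains B where "B \<subseteq> V" "orthonormal B" "\<And>x. x \<in> V \<Longrightarrow> \<forall>b\<in>B. cinner x b = 0 \<Longrightarrow> x = 0"
proof -
  let ?A = "{B. B \<subseteq> V \<and> orthonormal B}"
  have "\<exists>M\<in>?A. \<forall>X\<in>?A. M \<subseteq> X \<longrightarrow> X = M"
  proof (rule subset_Zorn')
    fix C assume "subset.chain ?A C"
    then have C: "C \<subseteq> ?A" "\<And>X Y. X \<in> C \<Longrightarrow> Y \<in> C \<Longrightarrow> X \<subseteq> Y \<or> Y \<subseteq> X"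
      by (auto simp: subset_chain_def)
    have "cinner x y = 0" if "x \<in> \<Union>C" "y \<in> \<Union>C" "x \<noteq> y" for x y
    proof -
      obtain X Y where XY: "X \<in> C" "x \<in> X" "Y \<in> C" "y \<in> Y" using \<open>x \<in> \<Union>C\<close> \<open>y \<in> \<Union>C\<close> by auto
      then obtain Z where "Z \<in> C" "x \<in> Z" "y \<in> Z" using C(2)[of X Y] by auto
      then show ?thesis using C(1) \<open>x \<noteq> y\<close> unfolding orthonormal_def by auto
    qed
    moreover have "cinner x x = 1" if "x \<in> \<Union>C" for x
      using C(1) that unfolding orthonormal_def by auto
    moreover have "\<Union>C \<subseteq> V" using C(1) by auto
    ultimately show "\<Union>C \<in> ?A" unfolding orthonormal_def by blast
  qed
  then obtain B where B: "B \<subseteq> V" "orthonormal B"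
    and max: "\<And>X. X \<subseteq> V \<Longrightarrow> orthonormal X \<Longrightarrow> B \<subseteq> X \<Longrightarrow> X = B" by auto
  have "x = 0" if x: "x \<in> V" "\<forall>b\<in>B. cinner x b = 0" for x
  proof (rule ccontr)
    assume "x \<noteq> 0"
    define u where "u = (1 / norm x) *\<^sub>R x"
    have u1: "cinner u u = 1" using \<open>x \<noteq> 0\<close> by (simp add: u_def cinner_self)
    have u0: "cinner u b = 0" "cinner b u = 0" if "b \<in> B" for b
      using x that by (auto simp: u_def scaleR_scaleC cinner_scaleC_left cinner_scaleC_right
          cinner_eq_0_commute[of b x])
    have "u \<in> V" using x V by (simp add: u_def csubspace_scaleR)
    then have "insert u B = B"
      using B u0 u1 by (intro max) (auto simp: orthonormal_def)
    then have "cinner u u = 0" using u0 by blast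
    then show False using u1 by simp
  qed
  then show thesis using that B by blast
qed

lemma orthonormal_sum_cinner:
  assumes "orthonormal B" "finite F" "F \<subseteq> B" "b \<in> B"
  shows "cinner (\<Sum>a\<in>F. c a *\<^sub>C a) b = (if b \<in> F then c b else 0)"
proof -
  have "cinner (\<Sum>a\<in>F. c a *\<^sub>C a) b = (\<Sum>a\<in>F. if a = b then c a else 0)"
    unfolding cinner_sum_left cinner_scaleC_left
    using assms by (intro sum.cong) (auto simp: orthonormal_def subset_iff)
  then show ?thesis using assms by simp
qed

lemma orthonormal_independent:
  assumes "orthonormal B"
  shows "\<not> complex_vector.dependent B"
proof
  assume "complex_vector.dependent B"
  then obtain F c b where F: "finite F" "F \<subseteq> B" "(\<Sum>a\<in>F. c a *\<^sub>C a) = 0" "b \<in> F" "c b \<noteq> 0"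
    unfolding complex_vector.dependent_explicit by blast
  then have "c b = 0" using orthonormal_sum_cinner[OF assms F(1,2), of b c] by auto
  then show False using F by simp
qed

lemma orthonormal_finite:
  assumes "orthonormal B" "B \<subseteq> V" "csubspace V" "finite_dim V"
  shows "finite B"
proof -
  obtain S where "finite S" "V \<subseteq> cspan S" using assms(3,4) by (auto simp: finite_dim_iff)
  then show ?thesis
    using complex_vector.independent_span_bound[OF _ orthonormal_independent[OF assms(1)]] assms(2)
    by blast
qed

text \<open>
  On the span of a finite orthonormal set the Fourier expansion is exact; its right-hand side is
  continuous in \<open>x\<close>, so the identity extends to the closure and the span is closed.
\<close>

lemma closure_cspan_orthonormal_finite:
  assumes B: "orthonormal B" and fin: "finite B"
  shows "closure (cspan B) = cspan B"
proof -
  define g where "g x = (\<Sum>b\<in>B. cinner x b *\<^sub>C b)" for x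
  have g: "g x = x" if "x \<in> cspan B" for x
  proof -
    obtain c where c: "x = (\<Sum>a\<in>B. c a *\<^sub>C a)"
      using \<open>x \<in> cspan B\<close> unfolding complex_vector.span_finite[OF fin] by blast
    have "cinner x b = c b" if "b \<in> B" for b
      using orthonormal_sum_cinner[OF B fin subset_refl that, of c] that by (simp add: c)
    then show ?thesis unfolding g_def c by (intro sum.cong) auto
  qed
  have gspan: "g x \<in> cspan B" for x
    unfolding g_def
    by (intro complex_vector.span_sum complex_vector.span_scale complex_vector.span_base)
  have "x \<in> cspan B" if x: "x \<in> closure (cspan B)" for x
  proof -
    obtain y where y: "\<And>k. y k \<in> cspan B" "y \<longlonglongrightarrow> x"
      using closure_sequenceE[OF x] by auto
    have "(\<lambda>k. g (y k)) \<longlonglongrightarrow> g x"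
      unfolding g_def by (intro tendsto_sum tendsto_scaleC_left tendsto_cinner_left y)
    then have "g x = x" using y LIMSEQ_unique by (simp add: g)
    then show ?thesis using gspan[of x] by simp
  qed
  then show ?thesis using closure_subset by blast
qed

lemma finite_dim_orthonormal_cspan:
  assumes V: "csubspace V" and "finite_dim V"
  obtains B where "finite B" "orthonormal B" "B \<subseteq> V" "V = cspan B"
proof -
  obtain B where B: "B \<subseteq> V" "orthonormal B" and max: "\<And>x. x \<in> V \<Longrightarrow> \<forall>b\<in>B. cinner x b = 0 \<Longrightarrow> x = 0"
    using maximal_orthonormal_exists[OF V] by blast
  have fin: "finite B" by (rule orthonormal_finite[OF B(2,1) assms])
  have BV: "cspan B \<subseteq> V" by (rule complex_vector.span_minimal[OF B(1) V])
  have "x \<in> cspan B" if x: "x \<in> V" for x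
  proof -
    define y where "y = (\<Sum>b\<in>B. cinner x b *\<^sub>C b)"
    have y: "y \<in> cspan B"
      unfolding y_def
      by (intro complex_vector.span_sum complex_vector.span_scale complex_vector.span_base)
    then have "x - y \<in> V" using BV x complex_vector.subspace_diff[OF V] by blast
    moreover have "cinner (x - y) b = 0" if "b \<in> B" for b
      using orthonormal_sum_cinner[OF B(2) fin subset_refl that, of "cinner x"] that
      by (simp add: cinner_diff_left y_def)
    ultimately have "x - y = 0" by (intro max) auto
    then show ?thesis using y by simp
  qed
  then show thesis using that fin B BV by blast
qed

text \<open>
A finite orthonormal basis reduces this to the closedness of the span of a finite orthonormal set.
\<close>

lemma finite_dim_closed:
  assumes "csubspace V" "finite_dim V"
  shows "closed V"
proof -
  obtain B where B: "finite B" "orthonormal B" "B \<subseteq> V" "V = cspan B"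
    by (rule finite_dim_orthonormal_cspan[OF assms])
  have "closure V = V"
    unfolding B(4) by (rule closure_cspan_orthonormal_finite[OF B(2,1)])
  then show ?thesis by (simp only: closure_eq)
qed

lemma csubspace_closure:
  assumes V: "csubspace V"
  shows "csubspace (closure V)"
proof (rule complex_vector.subspaceI)
  show "0 \<in> closure V" using complex_vector.subspace_0[OF V] closure_subset by blast
next
  fix x y assume "x \<in> closure V" "y \<in> closure V"
  then obtain f g where "\<And>k. f k \<in> V" "f \<longlonglongrightarrow> x" "\<And>k. g k \<in> V" "g \<longlonglongrightarrow> y"
    by (auto elim!: closure_sequenceE)
  then show "x + y \<in> closure V"
    unfolding closure_sequential using complex_vector.subspace_add[OF V]
    by (intro exI[of _ "\<lambda>k. f k + g k"]) (auto intro: tendsto_add)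
next
  fix c x assume "x \<in> closure V"
  then obtain f where f: "\<And>k. f k \<in> V" "f \<longlonglongrightarrow> x"
    by (auto elim!: closure_sequenceE)
  have "bounded_linear (\<lambda>x::'a. c *\<^sub>C x)"
    by (rule bounded_linear_intro[of _ "cmod c"])
      (auto simp: scaleC_add_right norm_scaleC scaleR_scaleC scaleC_scaleC mult.commute)
  then have "(\<lambda>k. c *\<^sub>C f k) \<longlonglongrightarrow> c *\<^sub>C x" using f(2) by (rule bounded_linear.tendsto)
  then show "c *\<^sub>C x \<in> closure V"
    unfolding closure_sequential using f complex_vector.subspace_scale[OF V]
    by (intro exI[of _ "\<lambda>k. c *\<^sub>C f k"]) auto
qed

text \<open>
A maximal orthonormal set \<open>B\<close> spans a dense subspace: its closed span is complete, so any \<open>x\<close> in \<open>V\<close>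
has a projection onto it, and the difference is orthogonal to \<open>B\<close>.
\<close>

lemma orthonormal_basis_exists:
  assumes V: "csubspace V" and cV: "complete V"
  shows "\<exists>B. orthonormal_basis V B"
proof -
  obtain B where B: "B \<subseteq> V" "orthonormal B" and max: "\<And>x. x \<in> V \<Longrightarrow> \<forall>b\<in>B. cinner x b = 0 \<Longrightarrow> x = 0"
    using maximal_orthonormal_exists[OF V] by blast
  define W where "W = closure (cspan B)"
  have WV: "W \<subseteq> V"
    unfolding W_def
    by (intro closure_minimal complex_vector.span_minimal[OF B(1) V] complete_imp_closed[OF cV])
  have W: "csubspace W" unfolding W_def by (rule csubspace_closure) (rule complex_vector.subspace_span)
  have cW: "complete W" using complete_closed_subset[OF _ WV cV] by (simp add: W_def)
  have BW: "B \<subseteq> W" unfolding W_def using complex_vector.span_superset closure_subset by blast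
  have "x \<in> W" if x: "x \<in> V" for x
  proof -
    obtain p where p: "p \<in> W" "\<And>w. w \<in> W \<Longrightarrow> cinner (x - p) w = 0"
      using orthogonal_projection_exists[OF W cW] by blast
    have "x - p \<in> V" using p(1) WV x complex_vector.subspace_diff[OF V] by blast
    then have "x - p = 0" by (rule max) (use p(2) BW in blast)
    then show ?thesis using p(1) by simp
  qed
  then have "orthonormal_basis V B" using B unfolding orthonormal_basis_def W_def by blast
  then show ?thesis by blast
qed

lemma hilbert_dim_basis:
  assumes "csubspace V" "complete V"
  obtains B where "orthonormal_basis V B" "hilbert_dim V = |B|"
  using that someI_ex[OF orthonormal_basis_exists[OF assms]] unfolding hilbert_dim_def by blast

lemma cfinite_card_of [simp]: "cfinite |B| \<longleftrightarrow> finite B"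
  by (simp add: cfinite_def Field_card_of)

lemma cinfinite_iff: "cinfinite r \<longleftrightarrow> \<not> cfinite r"
  by (simp add: cfinite_def cinfinite_def)

text \<open>
\<open>hilbert_dim\<close> picks an arbitrary orthonormal basis, and any choice decides finiteness in the same
way: a finite orthonormal set has closed span, so it spans \<open>V\<close> if it is a basis, and an orthonormal
set in a finite-dimensional space is finite by linear independence.
\<close>

lemma cfinite_hilbert_dim:
  assumes V: "csubspace V" and cV: "complete V"
  shows "cfinite (hilbert_dim V) \<longleftrightarrow> finite_dim V"
proof -
  obtain B where "orthonormal_basis V B" and dim: "hilbert_dim V = |B|"
    by (rule hilbert_dim_basis[OF assms])
  then have B: "B \<subseteq> V" "orthonormal B" "V \<subseteq> closure (cspan B)"
    unfolding orthonormal_basis_def by auto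
  have "finite_dim V" if "finite B"
    using closure_cspan_orthonormal_finite[OF B(2) that] B that by (auto simp: finite_dim_iff[OF V])
  moreover have "finite B" if "finite_dim V"
    by (rule orthonormal_finite[OF B(2,1) V that])
  ultimately show ?thesis by (auto simp: dim)
qed

section \<open>The open mapping theorem and closed ranges\<close>

text \<open>
If no \<open>C n\<close> had interior points in \<open>Y\<close>, the Baire category theorem would leave none for \<open>Y\<close> itself.
It is applied to \<open>Y\<close> as a metric space of its own, since the surrounding space may be incomplete.
\<close>

lemma Baire_closed_cover:
  fixes Y :: "'a::metric_space set" and C :: "nat \<Rightarrow> 'a set"
  assumes cY: "complete Y" and "Y \<noteq> {}" and C: "\<And>n. closed (C n)" and cov: "Y \<subseteq> (\<Union>n. C n)"
  shows "\<exists>n. \<exists>y\<in>Y. \<exists>r>0. \<forall>z\<in>Y. dist y z < r \<longrightarrow> z \<in> C n"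
proof -
  interpret M: Metric_space Y dist
    by unfold_locales (simp_all add: dist_commute dist_triangle)
  have lim: "limitin M.mtopology \<sigma> l sequentially" if "l \<in> Y" "range \<sigma> \<subseteq> Y" "\<sigma> \<longlonglongrightarrow> l" for \<sigma> l
    unfolding M.limitin_metric_dist_null
    using that(1,2) tendsto_dist_iff[THEN iffD1, OF that(3)] by (auto simp: image_subset_iff)
  have "M.mcomplete"
    unfolding M.mcomplete_def
  proof (intro allI impI)
    fix \<sigma> assume \<sigma>: "M.MCauchy \<sigma>"
    then have "Cauchy \<sigma>" "\<forall>k. \<sigma> k \<in> Y" by (auto simp: M.MCauchy_def Cauchy_def)
    then obtain l where "l \<in> Y" "\<sigma> \<longlonglongrightarrow> l"
      using cY unfolding complete_def by blast
    moreover have "range \<sigma> \<subseteq> Y" using \<open>\<forall>k. \<sigma> k \<in> Y\<close> by auto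
    ultimately show "\<exists>x. limitin M.mtopology \<sigma> x sequentially"
      using lim by blast
  qed
  moreover have "closedin M.mtopology (Y \<inter> C n)" for n
    unfolding M.closedin_metric
  proof (intro conjI allI impI)
    fix x assume x: "x \<in> Y - (Y \<inter> C n)"
    have "open (- C n)" using C[of n] by (rule open_Compl)
    then obtain r where r: "r > 0" "ball x r \<subseteq> - C n"
      using x open_contains_ball[of "- C n"] by auto
    then have "disjnt (Y \<inter> C n) (M.mball x r)"
      by (auto simp: disjnt_iff)
    then show "\<exists>r>0. disjnt (Y \<inter> C n) (M.mball x r)" using r by blast
  qed auto
  ultimately have "M.mtopology interior_of (\<Union>n. Y \<inter> C n) = {}"
    if "\<And>n. M.mtopology interior_of (Y \<inter> C n) = {}"
    using that by (intro M.metric_Baire_category_alt) auto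
  moreover have "(\<Union>n. Y \<inter> C n) = Y" using cov by auto
  moreover have "M.mtopology interior_of Y = Y"
    using interior_of_topspace[of M.mtopology] by simp
  ultimately obtain n where "M.mtopology interior_of (Y \<inter> C n) \<noteq> {}"
    using \<open>Y \<noteq> {}\<close> by auto
  then obtain y where "y \<in> M.mtopology interior_of (Y \<inter> C n)" by auto
  then obtain r where r: "y \<in> Y" "r > 0" "M.mball y r \<subseteq> Y \<inter> C n"
    unfolding M.in_interior_of_mball by blast
  then have "z \<in> C n" if "z \<in> Y" "dist y z < r" for z
    using that by (auto simp: subset_iff)
  then show ?thesis using r(1,2) by blast
qed

context
  fixes X :: "'x::real_normed_vector set" and Y :: "'y::real_normed_vector set"
    and S :: "'x \<Rightarrow> 'y" and K :: real
  assumes X: "subspace X" and cX: "complete X"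
    and Y: "subspace Y" and cY: "complete Y"
    and add: "\<And>x y. x \<in> X \<Longrightarrow> y \<in> X \<Longrightarrow> S (x + y) = S x + S y"
    and scale: "\<And>r x. x \<in> X \<Longrightarrow> S (r *\<^sub>R x) = r *\<^sub>R S x"
    and bound: "\<And>x. x \<in> X \<Longrightarrow> norm (S x) \<le> K * norm x"
    and onto: "S ` X = Y"
begin

private lemma S_diff: "x \<in> X \<Longrightarrow> y \<in> X \<Longrightarrow> S (x - y) = S x - S y"
  using add[of "x - y" y] X by (simp add: subspace_diff)

private lemma S_tendsto:
  assumes "\<And>k. u k \<in> X" "x \<in> X" "u \<longlonglongrightarrow> x"
  shows "(\<lambda>k. S (u k)) \<longlonglongrightarrow> S x"
proof -
  have lim: "(\<lambda>k. K * norm (u k - x)) \<longlonglongrightarrow> 0"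
    using assms(3) by (auto intro!: tendsto_mult_right_zero tendsto_norm_zero simp: LIM_zero)
  have bnd: "norm (S (u k) - S x) \<le> K * norm (u k - x)" for k
    using bound[of "u k - x"] assms X by (simp add: S_diff subspace_diff)
  have "(\<lambda>k. S (u k) - S x) \<longlonglongrightarrow> 0"
    by (intro Lim_null_comparison[OF _ lim] always_eventually allI bnd)
  then show ?thesis by (rule LIM_zero_cancel)
qed

text \<open>
By Baire, the closure of the image of some ball of radius \<open>n\<close> contains a ball of \<open>Y\<close> around some \<open>y0\<close>.
Differences then give approximate preimages of all small vectors, and scaling gives them for all
vectors, with norm controlled by a constant multiple of the norm.
\<close>

private lemma approximate_preimage:
  "\<exists>c\<ge>0. \<forall>y\<in>Y. \<forall>e>0. \<exists>x\<in>X. norm x \<le> c * norm y \<and> norm (y - S x) < e"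
proof -
  define A where "A n = S ` {x \<in> X. norm x \<le> real n}" for n
  have cov: "Y \<subseteq> (\<Union>n. closure (A n))"
  proof
    fix y assume "y \<in> Y"
    then obtain x where x: "x \<in> X" "y = S x" using onto by auto
    obtain n where "norm x \<le> real n" using real_arch_simple by blast
    then have "y \<in> A n" using x by (auto simp: A_def)
    then show "y \<in> (\<Union>n. closure (A n))" using closure_subset by blast
  qed
  have "Y \<noteq> {}" using subspace_0[OF Y] by auto
  obtain n y0 r where y0: "y0 \<in> Y" "r > 0"
    and ball: "\<And>z. z \<in> Y \<Longrightarrow> dist y0 z < r \<Longrightarrow> z \<in> closure (A n)"
    using Baire_closed_cover[where C = "\<lambda>n. closure (A n)", OF cY \<open>Y \<noteq> {}\<close> closed_closure cov]
    by blast
  have small: "\<exists>x\<in>X. norm x \<le> 2 * real n \<and> norm (y - S x) < e"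
    if y: "y \<in> Y" "norm y < r" and e: "e > 0" for y e
  proof -
    have "y0 \<in> closure (A n)" "y0 + y \<in> closure (A n)"
      using ball[of y0] ball[of "y0 + y"] y y0 Y by (auto simp: dist_norm subspace_add)
    then obtain a b where "a \<in> A n" "dist a y0 < e / 2" "b \<in> A n" "dist b (y0 + y) < e / 2"
      using e unfolding closure_approachable by (meson half_gt_zero)
    then obtain u v where u: "u \<in> X" "norm u \<le> real n" "dist (S u) y0 < e / 2"
      and v: "v \<in> X" "norm v \<le> real n" "dist (S v) (y0 + y) < e / 2"
      unfolding A_def by blast
    have "norm (v - u) \<le> 2 * real n" using u v norm_triangle_ineq4[of v u] by linarith
    moreover have "norm (y - S (v - u)) < e"
    proof -
      have "y - S (v - u) = (S u - y0) - (S v - (y0 + y))"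
        using u v by (simp add: S_diff)
      then have "norm (y - S (v - u)) \<le> norm (S u - y0) + norm (S v - (y0 + y))"
        using norm_triangle_ineq4[of "S u - y0" "S v - (y0 + y)"] by (simp only:)
      then show ?thesis using u(3) v(3) unfolding dist_norm by linarith
    qed
    ultimately show ?thesis using u v X subspace_diff by blast
  qed
  have "\<exists>x\<in>X. norm x \<le> (4 * real n / r) * norm y \<and> norm (y - S x) < e"
    if y: "y \<in> Y" and e: "e > 0" for y e
  proof (cases "y = 0")
    case True
    then show ?thesis using e X scale[of 0 0] subspace_0[OF X] by (intro bexI[of _ 0]) auto
  next
    case False
    \<comment> \<open>Scaling by \<open>t\<close> brings \<open>y\<close> to norm \<open>r / 2\<close>, inside the ball.\<close>
    define t where "t = r / (2 * norm y)"
    have t: "t > 0" using False y0 by (simp add: t_def)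
    have "t *\<^sub>R y \<in> Y" using y Y by (simp add: subspace_scale)
    moreover have "norm (t *\<^sub>R y) < r" using False y0 by (simp add: t_def)
    ultimately obtain x where x: "x \<in> X" "norm x \<le> 2 * real n" "norm (t *\<^sub>R y - S x) < t * e"
      using small[of "t *\<^sub>R y" "t * e"] t e by auto
    have "norm ((1 / t) *\<^sub>R x) \<le> (1 / t) * (2 * real n)"
      using x t by (simp add: divide_right_mono)
    also have "\<dots> = (4 * real n / r) * norm y" using False y0 by (simp add: t_def)
    finally have 1: "norm ((1 / t) *\<^sub>R x) \<le> (4 * real n / r) * norm y" .
    have "y - S ((1 / t) *\<^sub>R x) = (1 / t) *\<^sub>R (t *\<^sub>R y - S x)"
      using x t by (simp add: scale scaleR_diff_right)
    then have "norm (y - S ((1 / t) *\<^sub>R x)) = (1 / t) * norm (t *\<^sub>R y - S x)"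
      using t by simp
    also have "\<dots> < (1 / t) * (t * e)" using x t by (intro mult_strict_left_mono) auto
    finally have "norm (y - S ((1 / t) *\<^sub>R x)) < e" using t by simp
    then show ?thesis using 1 x X subspace_scale by blast
  qed
  then show ?thesis using y0(2) by (intro exI[of _ "4 * real n / r"]) auto
qed

text \<open>
  Approximate preimages are improved to exact ones by correcting the error repeatedly; the errors
  halve, so the corrections form a Cauchy series in the complete space \<open>X\<close>.
\<close>

theorem open_mapping:
  "\<exists>c. \<forall>y\<in>Y. \<exists>x\<in>X. S x = y \<and> norm x \<le> c * norm y"
proof -
  obtain c where c: "c \<ge> 0"
    "\<And>y e. y \<in> Y \<Longrightarrow> e > 0 \<Longrightarrow> \<exists>x\<in>X. norm x \<le> c * norm y \<and> norm (y - S x) < e"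
    using approximate_preimage by blast
  have "\<exists>x. x \<in> X \<and> norm x \<le> c * norm y \<and> norm (y - S x) \<le> norm y / 2" if y: "y \<in> Y" for y
  proof (cases "y = 0")
    case True
    then show ?thesis using X scale[of 0 0] subspace_0[OF X] by (intro exI[of _ 0]) auto
  next
    case False
    then show ?thesis using c(2)[OF y, of "norm y / 2"] by (auto intro: less_imp_le)
  qed
  then obtain g where g: "\<And>y. y \<in> Y \<Longrightarrow> g y \<in> X" "\<And>y. y \<in> Y \<Longrightarrow> norm (g y) \<le> c * norm y"
    "\<And>y. y \<in> Y \<Longrightarrow> norm (y - S (g y)) \<le> norm y / 2"
    by metis
  have "\<exists>x\<in>X. S x = y \<and> norm x \<le> (2 * c) * norm y" if y: "y \<in> Y" for y
  proof -
    define e where "e = rec_nat y (\<lambda>_ z. z - S (g z))"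
    have e0: "e 0 = y" and eS: "\<And>k. e (Suc k) = e k - S (g (e k))" by (simp_all add: e_def)
    have eY: "e k \<in> Y" for k
    proof (induction k)
      case (Suc k)
      then have "S (g (e k)) \<in> Y" using g(1) onto by blast
      then show ?case using Suc Y by (simp add: eS subspace_diff)
    qed (use y in \<open>simp add: e0\<close>)
    have en: "norm (e k) \<le> norm y / 2 ^ k" for k
    proof (induction k)
      case (Suc k)
      have "norm (e (Suc k)) \<le> norm (e k) / 2" using g(3)[OF eY] by (simp add: eS)
      then show ?case using Suc by simp
    qed (simp add: e0)
    define x where "x k = (\<Sum>i<k. g (e i))" for k
    have xX: "x k \<in> X" for k unfolding x_def using g(1)[OF eY] X by (intro subspace_sum) auto
    have Sx: "S (x k) = y - e k" for k
    proof (induction k)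
      case 0
      then show ?case using scale[of 0 0] subspace_0[OF X] by (simp add: x_def e0)
    next
      case (Suc k)
      have "S (x (Suc k)) = S (x k) + S (g (e k))"
        using add[OF xX[of k] g(1)[OF eY[of k]]] by (simp add: x_def)
      then show ?case using Suc by (simp add: eS)
    qed
    \<comment> \<open>The bound telescopes, since \<open>1/2^k - 1/2^(k+d)\<close> is the sum of \<open>1/2^(i+1)\<close> over \<open>k \<le> i < k+d\<close>.\<close>
    have diff: "norm (x (k + d) - x k) \<le> 2 * c * norm y * (1 / 2 ^ k - 1 / 2 ^ (k + d))" for k d
    proof (induction d)
      case (Suc d)
      have 1: "norm (x (k + Suc d) - x k) \<le> norm (x (k + d) - x k) + norm (g (e (k + d)))"
        using norm_triangle_ineq[of "x (k + d) - x k" "g (e (k + d))"]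
        by (simp add: x_def algebra_simps)
      have 2: "norm (g (e (k + d))) \<le> c * (norm y / 2 ^ (k + d))"
        using g(2)[OF eY, of "k + d"] mult_left_mono[OF en c(1), of "k + d"] by linarith
      have 3: "2 * c * norm y * (1 / 2 ^ k - 1 / 2 ^ (k + d)) + c * (norm y / 2 ^ (k + d))
          = 2 * c * norm y * (1 / 2 ^ k - 1 / 2 ^ (k + Suc d))"
        by (simp add: field_simps power_add)
      show ?case using Suc 1 2 3 by linarith
    qed simp
    have le: "norm (x m - x k) \<le> 2 * c * norm y * (1 / 2) ^ k" if "k \<le> m" for m k
    proof -
      have "norm (x m - x k) \<le> 2 * c * norm y * (1 / 2 ^ k - 1 / 2 ^ m)"
        using diff[of k "m - k"] that by simp
      also have "\<dots> \<le> 2 * c * norm y * (1 / 2 ^ k)"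
        using c by (intro mult_left_mono) auto
      finally show ?thesis by (simp add: power_one_over)
    qed
    have null: "(\<lambda>k. 2 * c * norm y * (1 / 2) ^ k) \<longlonglongrightarrow> 0"
      by (intro tendsto_mult_right_zero LIMSEQ_power_zero) simp
    have "Cauchy x"
    proof (rule metric_CauchyI)
      fix \<epsilon> :: real assume "\<epsilon> > 0"
      then obtain N where N: "2 * c * norm y * (1 / 2) ^ N < \<epsilon> / 2"
        using order_tendstoD(2)[OF null, of "\<epsilon> / 2"] by (auto simp: eventually_sequentially)
      have "dist (x m) (x n) < \<epsilon>" if "m \<ge> N" "n \<ge> N" for m n
        using le[OF that(1)] le[OF that(2)] N norm_triangle_ineq4[of "x m - x N" "x n - x N"]
        by (simp add: dist_norm)
      then show "\<exists>N. \<forall>m\<ge>N. \<forall>n\<ge>N. dist (x m) (x n) < \<epsilon>" by blast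
    qed
    then obtain l where l: "l \<in> X" "x \<longlonglongrightarrow> l"
      using cX xX by (auto simp: complete_def)
    have "(\<lambda>k. norm y / 2 ^ k) \<longlonglongrightarrow> 0"
      using tendsto_mult_right_zero[OF LIMSEQ_power_zero[of "1/2::real"], of "norm y"]
      by (simp add: power_one_over)
    then have "e \<longlonglongrightarrow> 0" by (rule Lim_null_comparison[rotated]) (simp add: en)
    then have "(\<lambda>k. S (x k)) \<longlonglongrightarrow> y"
      unfolding Sx using tendsto_diff[OF tendsto_const[of y], of e 0 sequentially] by simp
    then have "S l = y" using S_tendsto[OF xX l] LIMSEQ_unique by blast
    moreover have "norm l \<le> 2 * c * norm y"
    proof (rule LIMSEQ_le_const2[OF tendsto_norm[OF l(2)]])
      have "norm (x k) \<le> 2 * c * norm y" for k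
        using le[of 0 k] by (simp add: x_def)
      then show "\<exists>N. \<forall>k\<ge>N. norm (x k) \<le> 2 * c * norm y" by blast
    qed
    ultimately show ?thesis using l(1) by blast
  qed
  then show ?thesis by blast
qed

text \<open>
If \<open>S x\<close> is a limit of points of \<open>S M\<close>, the open mapping theorem supplies \<open>u\<^sub>k\<close> tending to \<open>0\<close> with
\<open>S (x + u\<^sub>k)\<close> in \<open>S M\<close>; as \<open>M\<close> contains the kernel, \<open>x + u\<^sub>k\<close> lies in \<open>M\<close>, and so does its limit \<open>x\<close>.
This is the source of every closed range below.
\<close>

theorem closed_image_of_saturated:
  assumes M: "subspace M" "closed M" "M \<subseteq> X" and ker: "\<And>x. x \<in> X \<Longrightarrow> S x = 0 \<Longrightarrow> x \<in> M"
  shows "closed (S ` M)"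
  unfolding closed_sequential_limits
proof (intro allI impI, elim conjE)
  fix y l assume y: "\<forall>k. y k \<in> S ` M" and lim: "y \<longlonglongrightarrow> l"
  obtain c where c: "\<And>y. y \<in> Y \<Longrightarrow> \<exists>x\<in>X. S x = y \<and> norm x \<le> c * norm y"
    using open_mapping by blast
  have yY: "y k \<in> Y" for k using y M(3) onto by auto
  then have lY: "l \<in> Y"
    using complete_imp_closed[OF cY] lim by (auto simp: closed_sequential_limits)
  then obtain x where x: "x \<in> X" "S x = l" using onto by auto
  have "\<exists>u. u \<in> X \<and> S u = y k - l \<and> norm u \<le> c * norm (y k - l)" for k
    using c[of "y k - l"] yY lY Y by (auto simp: subspace_diff)
  then obtain u where u: "\<And>k. u k \<in> X" "\<And>k. S (u k) = y k - l" "\<And>k. norm (u k) \<le> c * norm (y k - l)"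
    by metis
  have "(\<lambda>k. c * norm (y k - l)) \<longlonglongrightarrow> 0"
    using lim by (auto intro!: tendsto_mult_right_zero tendsto_norm_zero simp: LIM_zero)
  then have "u \<longlonglongrightarrow> 0" by (rule Lim_null_comparison[rotated]) (simp add: u)
  then have "(\<lambda>k. x + u k) \<longlonglongrightarrow> x" using tendsto_add[OF tendsto_const[of x], of u 0] by simp
  moreover have xuM: "x + u k \<in> M" for k
  proof -
    obtain m where m: "m \<in> M" "y k = S m" using y by auto
    then have mX: "m \<in> X" using M(3) by blast
    have "S (x + u k - m) = 0"
      using m mX x u X by (simp add: S_diff add subspace_add)
    then have "x + u k - m \<in> M" using ker x u X mX by (simp add: subspace_add subspace_diff)
    then show ?thesis using m(1) subspace_add[OF M(1)] by fastforce
  qed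
  ultimately have "x \<in> M" by (intro closed_sequentially[OF M(2) xuM])
  then show "l \<in> S ` M" using x by blast
qed

end

lemma csubspace_imp_subspace: "csubspace V \<Longrightarrow> subspace V"
  by (simp add: subspace_def csubspace_scaleR complex_vector.subspace_0 complex_vector.subspace_add)

lemma complete_Times:
  fixes A :: "'a::metric_space set" and B :: "'b::metric_space set"
  assumes "complete A" "complete B"
  shows "complete (A \<times> B)"
  unfolding complete_def
proof (intro allI impI, elim conjE)
  fix f :: "nat \<Rightarrow> 'a \<times> 'b" assume f: "\<forall>n. f n \<in> A \<times> B" "Cauchy f"
  have "\<forall>n. fst (f n) \<in> A" "\<forall>n. snd (f n) \<in> B" using f(1) by (auto simp: mem_Times_iff)
  then obtain a b where ab: "a \<in> A" "(\<lambda>n. fst (f n)) \<longlonglongrightarrow> a" "b \<in> B" "(\<lambda>n. snd (f n)) \<longlonglongrightarrow> b"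
    using assms Cauchy_fst[OF f(2)] Cauchy_snd[OF f(2)] unfolding complete_def by meson
  have "f \<longlonglongrightarrow> (a, b)" using tendsto_Pair[OF ab(2,4)] by simp
  then show "\<exists>l\<in>A \<times> B. f \<longlonglongrightarrow> l" using ab by blast
qed

section \<open>Kernel and range of a bounded operator\<close>

lemma hilbert_spaceD: "hilbert_space H \<Longrightarrow> csubspace H" "hilbert_space H \<Longrightarrow> complete H"
  unfolding hilbert_space_def by auto

lemma bounded_ops_clinear_on: "T \<in> bounded_ops H K \<Longrightarrow> clinear_on H T"
  unfolding bounded_ops_def clinear_on_def by blast

lemma bounded_ops_mem: "T \<in> bounded_ops H K \<Longrightarrow> x \<in> H \<Longrightarrow> T x \<in> K"
  unfolding bounded_ops_def by blast

lemma bounded_opsE: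
  assumes "T \<in> bounded_ops H K"
  obtains M where "M \<ge> 0" "\<And>x. x \<in> H \<Longrightarrow> norm (T x) \<le> M * norm x"
proof -
  obtain M where M: "\<forall>x\<in>H. norm (T x) \<le> M * norm x"
    using assms unfolding bounded_ops_def by auto
  have "norm (T x) \<le> \<bar>M\<bar> * norm x" if "x \<in> H" for x
    using M that mult_right_mono[of M "\<bar>M\<bar>" "norm x"] by fastforce
  then show thesis using that[of "\<bar>M\<bar>"] by simp
qed

context
  fixes H :: "'a::complex_inner set"
  assumes H: "hilbert_space H"
begin

private lemmas subspaceH = hilbert_spaceD(1)[OF H] and completeH = hilbert_spaceD(2)[OF H]

lemma csubspace_orthogonal_complement: "csubspace (orthogonal_complement H R)"
  unfolding orthogonal_complement_def
  by (rule complex_vector.subspaceI)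
    (use subspaceH in \<open>auto simp: complex_vector.subspace_0 complex_vector.subspace_add
      complex_vector.subspace_scale cinner_add_left cinner_scaleC_left\<close>)

lemma complete_orthogonal_complement: "complete (orthogonal_complement H R)"
proof -
  have "closed (orthogonal_complement H R)"
    unfolding closed_sequential_limits
  proof (intro allI impI, elim conjE)
    fix u l assume u: "\<forall>k. u k \<in> orthogonal_complement H R" and lim: "u \<longlonglongrightarrow> l"
    have "l \<in> H"
      using complete_imp_closed[OF completeH] u lim by (auto simp: closed_sequential_limits orthogonal_complement_def)
    moreover have "cinner l y = 0" if "y \<in> R" for y
      using tendsto_cinner_left[OF lim, of y] u that
      by (simp add: orthogonal_complement_def LIMSEQ_const_iff)
    ultimately show "l \<in> orthogonal_complement H R" by (simp add: orthogonal_complement_def)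
  qed
  then show ?thesis
    by (rule complete_closed_subset[OF _ _ completeH]) (auto simp: orthogonal_complement_def)
qed

lemma orthogonal_decomposition:
  assumes R: "csubspace R" "R \<subseteq> H" "closed R" and x: "x \<in> H"
  obtains r w where "r \<in> R" "w \<in> orthogonal_complement H R" "x = r + w"
proof -
  have "complete R" by (rule complete_closed_subset[OF R(3,2) completeH])
  then obtain p where p: "p \<in> R" "\<And>w. w \<in> R \<Longrightarrow> cinner (x - p) w = 0"
    using orthogonal_projection_exists[OF R(1)] by blast
  have "x - p \<in> orthogonal_complement H R"
    using p x R(2) complex_vector.subspace_diff[OF subspaceH] by (auto simp: orthogonal_complement_def)
  then show thesis using that[of p "x - p"] p(1) by simp
qed

text \<open>
Extend a basis \<open>B0\<close> of \<open>R\<close> to a basis \<open>B1\<close> of \<open>H\<close>; the added vectors form a basis modulo \<open>R\<close>.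
\<close>

lemma quotient_basis_exists:
  assumes R: "csubspace R" "R \<subseteq> H"
  shows "\<exists>B. quotient_basis H R B"
proof -
  obtain B0 where B0: "B0 \<subseteq> R" "\<not> complex_vector.dependent B0" "R \<subseteq> cspan B0"
    using complex_vector.maximal_independent_subset[of R] by auto
  have RB0: "R = cspan B0" using B0 complex_vector.span_minimal[OF B0(1) R(1)] by auto
  have "B0 \<subseteq> H" using B0 R by auto
  obtain B1 where B1: "B0 \<subseteq> B1" "B1 \<subseteq> H" "\<not> complex_vector.dependent B1" "H \<subseteq> cspan B1"
    using complex_vector.maximal_independent_subset_extend[OF \<open>B0 \<subseteq> H\<close> B0(2)] by auto
  have "c b = 0" if F: "finite F" "F \<subseteq> B1 - B0" "(\<Sum>b\<in>F. c b *\<^sub>C b) \<in> R" "b \<in> F" for F c b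
  proof -
    obtain F0 c0 where F0: "finite F0" "F0 \<subseteq> B0" "(\<Sum>b\<in>F. c b *\<^sub>C b) = (\<Sum>b\<in>F0. c0 b *\<^sub>C b)"
      using F(3) unfolding RB0 complex_vector.span_explicit by auto
    \<comment> \<open>A relation modulo \<open>R\<close> becomes a linear relation among vectors of \<open>B1\<close>.\<close>
    define d where "d b = (if b \<in> F0 then - c0 b else c b)" for b
    have "F \<inter> F0 = {}" using F F0 by auto
    have "(\<Sum>b\<in>F \<union> F0. d b *\<^sub>C b) = (\<Sum>b\<in>F. d b *\<^sub>C b) + (\<Sum>b\<in>F0. d b *\<^sub>C b)"
      by (rule sum.union_disjoint) fact+
    also have "(\<Sum>b\<in>F. d b *\<^sub>C b) = (\<Sum>b\<in>F. c b *\<^sub>C b)"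
      using \<open>F \<inter> F0 = {}\<close> by (intro sum.cong) (auto simp: d_def)
    also have "(\<Sum>b\<in>F0. d b *\<^sub>C b) = - (\<Sum>b\<in>F0. c0 b *\<^sub>C b)"
      by (simp add: d_def sum_negf)
    finally have "(\<Sum>b\<in>F \<union> F0. d b *\<^sub>C b) = 0" using F0(3) by simp
    moreover have "finite (F \<union> F0)" "F \<union> F0 \<subseteq> B1" "b \<in> F \<union> F0" using F F0 B1 by auto
    ultimately have "d b = 0"
      using B1(3) unfolding complex_vector.dependent_explicit by blast
    moreover have "b \<notin> F0" using F(4) \<open>F \<inter> F0 = {}\<close> by blast
    ultimately show "c b = 0" by (simp add: d_def)
  qed
  moreover have "\<exists>y\<in>cspan (B1 - B0). x - y \<in> R" if "x \<in> H" for x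
  proof -
    have "x \<in> cspan ((B1 - B0) \<union> B0)" using B1 that by (auto simp: Un_absorb2)
    then obtain y z where "y \<in> cspan (B1 - B0)" "z \<in> cspan B0" "x = y + z"
      unfolding complex_vector.span_Un by auto
    then show ?thesis using RB0 by (intro bexI[of _ y]) auto
  qed
  ultimately have "quotient_basis H R (B1 - B0)"
    unfolding quotient_basis_def using B1(2) by auto
  then show ?thesis by blast
qed

end

context
  fixes H :: "'a::complex_inner set" and T :: "'a \<Rightarrow> 'a"
  assumes H: "hilbert_space H" and T: "T \<in> bounded_ops H H"
begin

private lemmas Hs = hilbert_spaceD(1)[OF H] and cH = hilbert_spaceD(2)[OF H]
private lemmas Tl = bounded_ops_clinear_on[OF T]

lemma csubspace_op_kernel: "csubspace (op_kernel H T)"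
  using csubspace_vimage[OF Hs Tl complex_vector.subspace_single_0] by (simp add: op_kernel_def)

lemma csubspace_op_range: "csubspace (op_range H T)"
  by (rule csubspace_image[OF Hs Tl])

lemma op_range_subset: "op_range H T \<subseteq> H"
  using bounded_ops_mem[OF T] by blast

lemma complete_op_kernel: "complete (op_kernel H T)"
proof -
  obtain M where M: "\<And>x. x \<in> H \<Longrightarrow> norm (T x) \<le> M * norm x" using bounded_opsE[OF T] by blast
  have "closed (op_kernel H T)"
    unfolding closed_sequential_limits
  proof (intro allI impI, elim conjE)
    fix u l assume u: "\<forall>k. u k \<in> op_kernel H T" and lim: "u \<longlonglongrightarrow> l"
    have uH: "u k \<in> H" "T (u k) = 0" for k using u by (auto simp: op_kernel_def)
    have l: "l \<in> H" using complete_imp_closed[OF cH] uH lim by (auto simp: closed_sequential_limits)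
    have "norm (T l) \<le> M * norm (l - u k)" for k
      using M[of "l - u k"] l uH[of k] clinear_on_diff[OF Hs Tl, of l "u k"]
        complex_vector.subspace_diff[OF Hs] by simp
    moreover have "(\<lambda>k. M * norm (l - u k)) \<longlonglongrightarrow> M * norm (l - l)"
      by (intro tendsto_intros lim)
    ultimately have "norm (T l) \<le> M * norm (l - l)" by (intro LIMSEQ_le_const) auto
    then show "l \<in> op_kernel H T" using l by (simp add: op_kernel_def)
  qed
  then show ?thesis by (rule complete_closed_subset[OF _ _ cH]) (auto simp: op_kernel_def)
qed

lemma cfinite_alpha_iff: "cfinite (alpha H T) \<longleftrightarrow> finite_dim (op_kernel H T)"
  unfolding alpha_def by (rule cfinite_hilbert_dim[OF csubspace_op_kernel complete_op_kernel])

text \<open>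
Let \<open>F\<close> be a finite-dimensional space with \<open>T H + F = H\<close>. Then \<open>S (x, f) = T x + f\<close> maps the
complete space \<open>H \<times> F\<close> onto \<open>H\<close>, and the range of \<open>T\<close> is the image of \<open>H \<times> (T H \<inter> F)\<close>. That subspace
is closed because its second factor is finite-dimensional, and it contains the kernel of \<open>S\<close>.
\<close>

lemma closed_op_range_of_finite_codim:
  assumes fin: "finite_over H (op_range H T)"
  shows "closed (op_range H T)"
proof -
  let ?R = "op_range H T"
  obtain S0 where S0: "finite S0" "S0 \<subseteq> H" "\<forall>x\<in>H. \<exists>y\<in>cspan S0. x - y \<in> ?R"
    using fin unfolding finite_over_def by blast
  define F where "F = cspan S0"
  have F: "csubspace F" "F \<subseteq> H" "finite_dim F"
    unfolding F_def using S0 Hs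
    by (simp_all add: complex_vector.subspace_span complex_vector.span_minimal finite_dim_cspan)
  have cF: "complete F" by (rule complete_closed_subset[OF finite_dim_closed[OF F(1,3)] F(2) cH])
  have RF: "csubspace (?R \<inter> F)" "finite_dim (?R \<inter> F)"
    using csubspace_op_range F finite_dim_subspace[OF F(3), of "?R \<inter> F"]
    by (simp_all add: complex_vector.subspace_inter)
  obtain M where M: "M \<ge> 0" "\<And>x. x \<in> H \<Longrightarrow> norm (T x) \<le> M * norm x" using bounded_opsE[OF T] by blast
  define S where "S z = T (fst z) + snd z" for z
  have TR: "T (r *\<^sub>R x) = r *\<^sub>R T x" if "x \<in> H" for r x
    using clinear_on_scaleC[OF Hs Tl that] by (simp add: scaleR_scaleC)
  have "closed (S ` (H \<times> (?R \<inter> F)))"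
  proof (rule closed_image_of_saturated[where X = "H \<times> F" and Y = H and S = S and K = "M + 1"])
    show "subspace (H \<times> F)" "subspace (H \<times> (?R \<inter> F))" "subspace H"
      using Hs F RF by (simp_all add: subspace_Times csubspace_imp_subspace)
    show "complete (H \<times> F)" "complete H" using cH cF by (simp_all add: complete_Times)
    show "closed (H \<times> (?R \<inter> F))"
      using RF finite_dim_closed complete_imp_closed[OF cH] by (intro closed_Times) auto
    show "H \<times> (?R \<inter> F) \<subseteq> H \<times> F" by auto
    show "S ` (H \<times> F) = H"
    proof
      show "S ` (H \<times> F) \<subseteq> H"
        using F(2) op_range_subset complex_vector.subspace_add[OF Hs] by (fastforce simp: S_def)
      show "H \<subseteq> S ` (H \<times> F)"
      proof
        fix x assume "x \<in> H"
        then obtain y z where "y \<in> F" "z \<in> H" "x - y = T z" using S0(3) unfolding F_def by auto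
        then have "x = S (z, y)" "(z, y) \<in> H \<times> F" by (simp_all add: S_def algebra_simps)
        then show "x \<in> S ` (H \<times> F)" by blast
      qed
    qed
    show "S (u + v) = S u + S v" if "u \<in> H \<times> F" "v \<in> H \<times> F" for u v
      using that clinear_on_add[OF Hs Tl] by (auto simp: S_def)
    show "S (r *\<^sub>R u) = r *\<^sub>R S u" if "u \<in> H \<times> F" for r u
      using that TR by (auto simp: S_def scaleR_add_right)
    show "norm (S u) \<le> (M + 1) * norm u" if "u \<in> H \<times> F" for u
    proof -
      have "norm (S u) \<le> norm (T (fst u)) + norm (snd u)"
        unfolding S_def by (rule norm_triangle_ineq)
      also have "\<dots> \<le> M * norm u + norm u"
        using M that norm_fst_le[of "fst u" "snd u"] norm_snd_le[of "snd u" "fst u"]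
          mult_left_mono[of "norm (fst u)" "norm u" M] by (fastforce simp: mem_Times_iff)
      finally show ?thesis by (simp add: algebra_simps)
    qed
    show "u \<in> H \<times> (?R \<inter> F)" if u: "u \<in> H \<times> F" "S u = 0" for u
    proof -
      have "snd u = - T (fst u)" using u(2) by (simp add: S_def add_eq_0_iff)
      then have "snd u \<in> ?R"
        using u(1) complex_vector.subspace_neg[OF csubspace_op_range] by (auto simp: mem_Times_iff)
      then show ?thesis using u(1) by (auto simp: mem_Times_iff)
    qed
  qed
  moreover have "S ` (H \<times> (?R \<inter> F)) = ?R"
  proof
    show "S ` (H \<times> (?R \<inter> F)) \<subseteq> ?R"
      using complex_vector.subspace_add[OF csubspace_op_range] by (auto simp: S_def)
    show "?R \<subseteq> S ` (H \<times> (?R \<inter> F))"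
    proof
      fix y assume "y \<in> ?R"
      then obtain x where "x \<in> H" "y = T x" by auto
      then have "y = S (x, 0)" "(x, 0) \<in> H \<times> (?R \<inter> F)"
        using complex_vector.subspace_0[OF RF(1)] by (auto simp: S_def)
      then show "y \<in> S ` (H \<times> (?R \<inter> F))" by blast
    qed
  qed
  ultimately show ?thesis by simp
qed

text \<open>
For a closed range, \<open>\<beta>\<close> is the dimension of the orthogonal complement, which is then an algebraic
complement as well. For a range that is not closed, \<open>\<beta>\<close> is read off from a basis of the quotient;
that both sides are then false is a consequence of \<open>closed_op_range_of_finite_codim\<close>.
\<close>

lemma cfinite_beta_iff: "cfinite (beta H T) \<longleftrightarrow> finite_over H (op_range H T)"
proof
  let ?R = "op_range H T" and ?N = "orthogonal_complement H (op_range H T)"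
  note N = csubspace_orthogonal_complement[OF H, of ?R] complete_orthogonal_complement[OF H, of ?R]
  {
    assume fin: "cfinite (beta H T)"
    show "finite_over H ?R"
    proof (cases "closed ?R")
      case True
      then have "finite_dim ?N"
        using fin cfinite_hilbert_dim[OF N] by (simp add: beta_def)
      then obtain S where S: "finite S" "S \<subseteq> ?N" "?N \<subseteq> cspan S" by (auto simp: finite_dim_iff[OF N(1)])
      have "\<exists>y\<in>cspan S. x - y \<in> ?R" if x: "x \<in> H" for x
      proof -
        obtain r w where "r \<in> ?R" "w \<in> ?N" "x = r + w"
          using orthogonal_decomposition[OF H csubspace_op_range op_range_subset True x] by blast
        then show ?thesis using S(3) by (intro bexI[of _ w]) auto
      qed
      moreover have "S \<subseteq> H" using S(2) by (auto simp: orthogonal_complement_def)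
      ultimately show ?thesis unfolding finite_over_def using S(1) by auto
    next
      case False
      define B where "B = (SOME B. quotient_basis H ?R B)"
      have B: "quotient_basis H ?R B"
        unfolding B_def by (rule someI_ex[OF quotient_basis_exists[OF H csubspace_op_range op_range_subset]])
      have "finite B" using fin False by (simp add: beta_def quotient_dim_def B_def[symmetric])
      then show ?thesis using B unfolding finite_over_def quotient_basis_def by auto
    qed
  }
  {
    assume fin: "finite_over H ?R"
    have cl: "closed ?R" by (rule closed_op_range_of_finite_codim[OF fin])
    have "finite_over ?N (?N \<inter> ?R)"
      by (rule finite_over_subspace[OF N(1) csubspace_op_range fin]) (auto simp: orthogonal_complement_def)
    moreover have "?N \<inter> ?R \<subseteq> {0}" by (auto simp: orthogonal_complement_def)
    ultimately have "finite_dim ?N" by (rule finite_over_mono)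
    then show "cfinite (beta H T)" using cfinite_hilbert_dim[OF N] cl by (simp add: beta_def)
  }
qed

end

lemma Phi_iff:
  assumes "hilbert_space H" "T \<in> bounded_ops H H"
  shows "T \<in> Phi H \<longleftrightarrow> finite_dim (op_kernel H T) \<and> finite_over H (op_range H T)"
  unfolding Phi_def Phi_plus_def Phi_minus_def
  using assms cfinite_alpha_iff[OF assms] cfinite_beta_iff[OF assms] closed_op_range_of_finite_codim[OF assms]
  by auto

section \<open>Partial isometries between subspaces of equal Hilbert dimension\<close>

lemma orthonormal_basis_total:
  assumes B: "orthonormal_basis V B" and x: "x \<in> V" "\<And>b. b \<in> B \<Longrightarrow> cinner x b = 0"
  shows "x = 0"
proof -
  have "x \<in> closure (cspan B)" using B x(1) unfolding orthonormal_basis_def by blast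
  then obtain y where y: "\<And>k. y k \<in> cspan B" "y \<longlonglongrightarrow> x" by (auto elim!: closure_sequenceE)
  have perp: "cinner z x = 0" if "z \<in> cspan B" for z
    using that
  proof (induction rule: complex_vector.span_induct_alt)
    case (step c b z)
    then have "cinner b x = 0" using x(2) cinner_eq_0_commute by blast
    then show ?case using step by (simp add: cinner_add_left cinner_scaleC_left)
  qed simp
  have "(\<lambda>k. cinner (y k) x) \<longlonglongrightarrow> cinner x x" by (rule tendsto_cinner_left[OF y(2)])
  then have "cinner x x = 0" using perp[OF y(1)] by (simp add: LIMSEQ_const_iff)
  then show ?thesis by simp
qed

text \<open>
A form of the Riesz-Fischer theorem: a bijection between orthonormal bases carries the Fourier coefficients of
\<open>x\<close> to those of a vector \<open>y\<close> of the same norm. For finite combinations of \<open>B\<close> this is immediate. In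
general \<open>x\<close> is a limit of such combinations; their partners form a Cauchy sequence, because
differences of partners are partners of differences, and partners are unique.
\<close>

lemma isometric_partner:
  assumes K: "csubspace K" and N: "csubspace N" and cN: "complete N"
    and B: "orthonormal_basis K B" and B': "orthonormal_basis N B'" and f: "bij_betw f B B'"
    and x: "x \<in> K"
  shows "\<exists>y\<in>N. norm y = norm x \<and> (\<forall>b\<in>B. cinner y (f b) = cinner x b)"
proof -
  have BK: "B \<subseteq> K" "orthonormal B" "K \<subseteq> closure (cspan B)" using B by (auto simp: orthonormal_basis_def)
  have BN: "B' \<subseteq> N" "orthonormal B'" using B' by (auto simp: orthonormal_basis_def)
  have fB: "f b \<in> B'" if "b \<in> B" for b using f that by (auto simp: bij_betw_def)
  have inj: "f a = f b \<longleftrightarrow> a = b" if "a \<in> B" "b \<in> B" for a b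
    using f that by (auto simp: bij_betw_def inj_on_def)
  have fin: "\<exists>y\<in>N. norm y = norm x \<and> (\<forall>b\<in>B. cinner y (f b) = cinner x b)"
    if x: "x \<in> cspan B" for x
  proof -
    obtain F c where F: "finite F" "F \<subseteq> B" "x = (\<Sum>a\<in>F. c a *\<^sub>C a)"
      using x unfolding complex_vector.span_explicit by auto
    define y where "y = (\<Sum>a\<in>F. c a *\<^sub>C f a)"
    have yN: "y \<in> N"
      unfolding y_def using F fB BN(1)
      by (intro complex_vector.subspace_sum[OF N] complex_vector.subspace_scale[OF N]) auto
    have pair: "cinner y (f b) = cinner x b" if b: "b \<in> B" for b
    proof -
      have "cinner y (f b) = (\<Sum>a\<in>F. if a = b then c a else 0)"
        unfolding y_def cinner_sum_left cinner_scaleC_left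
        using F(2) fB BN(2) b inj by (intro sum.cong) (auto simp: orthonormal_def subset_iff)
      also have "\<dots> = cinner x b"
        using orthonormal_sum_cinner[OF BK(2) F(1,2) b, of c] F(1) by (simp add: F(3))
      finally show ?thesis .
    qed
    have "cinner y y = (\<Sum>a\<in>F. c a * cinner (f a) y)"
      by (subst (1) y_def) (simp add: cinner_sum_left cinner_scaleC_left)
    also have "\<dots> = (\<Sum>a\<in>F. c a * cinner a x)"
    proof (rule sum.cong[OF refl])
      fix a assume "a \<in> F"
      then have "cnj (cinner y (f a)) = cnj (cinner x a)" using pair F(2) by auto
      then show "c a * cinner (f a) y = c a * cinner a x"
        using cinner_commute[of "f a" y] cinner_commute[of a x] by simp
    qed
    also have "\<dots> = cinner x x"
      by (subst (2) F(3)) (simp add: cinner_sum_left cinner_scaleC_left)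
    finally have "(norm y)\<^sup>2 = (norm x)\<^sup>2" by (simp only: cinner_self of_real_eq_iff)
    then have "norm y = norm x" by (simp add: power2_eq_iff_nonneg)
    then show ?thesis using yN pair by blast
  qed
  obtain u where u: "\<And>k. u k \<in> cspan B" "u \<longlonglongrightarrow> x"
    using BK(3) x by (auto elim!: closure_sequenceE dest: subsetD)
  have "\<exists>y. y \<in> N \<and> (\<forall>b\<in>B. cinner y (f b) = cinner (u k) b) \<and> norm y = norm (u k)" for k
    using fin[OF u(1)[of k]] by auto
  then obtain v where v: "\<And>k. v k \<in> N" "\<And>k b. b \<in> B \<Longrightarrow> cinner (v k) (f b) = cinner (u k) b"
    "\<And>k. norm (v k) = norm (u k)" by metis
  have iso: "dist (v k) (v m) = dist (u k) (u m)" for k m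
  proof -
    have "u k - u m \<in> cspan B" by (rule complex_vector.span_diff[OF u(1) u(1)])
    then obtain y where y: "y \<in> N" "norm y = norm (u k - u m)"
      "\<forall>b\<in>B. cinner y (f b) = cinner (u k - u m) b" using fin by auto
    have "v k - v m - y = 0"
    proof (rule orthonormal_basis_total[OF B'])
      show "v k - v m - y \<in> N" using v(1) y(1) by (simp add: complex_vector.subspace_diff[OF N])
      fix b' assume "b' \<in> B'"
      then obtain b where "b \<in> B" "b' = f b" using f by (auto simp: bij_betw_def)
      then show "cinner (v k - v m - y) b' = 0" using v(2) y(3) by (simp add: cinner_diff_left)
    qed
    then show ?thesis using y(2) by (simp add: dist_norm)
  qed
  have "Cauchy u" using u(2) by (rule LIMSEQ_imp_Cauchy)
  then have "Cauchy v" unfolding Cauchy_def iso .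
  then obtain y where y: "y \<in> N" "v \<longlonglongrightarrow> y" using cN v(1) unfolding complete_def by blast
  have "(\<lambda>k. norm (v k)) \<longlonglongrightarrow> norm x" unfolding v(3) by (intro tendsto_norm u)
  then have "norm y = norm x" using tendsto_norm[OF y(2)] LIMSEQ_unique by blast
  moreover have "cinner y (f b) = cinner x b" if b: "b \<in> B" for b
  proof -
    have "(\<lambda>k. cinner (v k) (f b)) \<longlonglongrightarrow> cinner x b"
      unfolding v(2)[OF b] by (intro tendsto_cinner_left u)
    then show ?thesis using tendsto_cinner_left[OF y(2)] LIMSEQ_unique by blast
  qed
  ultimately show ?thesis using y(1) by blast
qed

text \<open>
\<open>U x\<close> is the vector of \<open>N\<close> whose coefficient at \<open>f b\<close> is \<open>cinner x b\<close>. Since a vector of \<open>N\<close> is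
determined by its coefficients, linearity is immediate, and vectors orthogonal to \<open>K\<close> are sent to
\<open>0\<close>. Existence of partners from \<open>K\<close> to \<open>N\<close> makes \<open>U\<close> well-defined, and from \<open>N\<close> to \<open>K\<close>, with the
inverse bijection, it makes \<open>U\<close> map \<open>K\<close> onto \<open>N\<close>.
\<close>

lemma partial_isometry_exists:
  assumes K: "csubspace K" "complete K" and N: "csubspace N" "complete N"
    and dim: "hilbert_dim K =o hilbert_dim N"
  shows "\<exists>U. (\<forall>H L. N \<subseteq> L \<longrightarrow> U \<in> bounded_ops H L) \<and> (\<forall>x. U x \<in> N) \<and>
    (\<forall>x\<in>K. U x = 0 \<longrightarrow> x = 0) \<and> (\<forall>y\<in>N. \<exists>x\<in>K. U x = y) \<and>
    (\<forall>x y. (\<forall>k\<in>K. cinner y k = 0) \<longrightarrow> U (x + y) = U x)"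
proof -
  obtain B where B: "orthonormal_basis K B" "hilbert_dim K = |B|" by (rule hilbert_dim_basis[OF K])
  obtain B' where B': "orthonormal_basis N B'" "hilbert_dim N = |B'|" by (rule hilbert_dim_basis[OF N])
  obtain f where f: "bij_betw f B B'" using dim B B' card_of_ordIso by metis
  have BK: "B \<subseteq> K" using B by (simp add: orthonormal_basis_def)
  have partner: "\<exists>y\<in>N. norm y \<le> norm x \<and> (\<forall>b\<in>B. cinner y (f b) = cinner x b)" for x
  proof -
    obtain p where p: "p \<in> K" "\<And>w. w \<in> K \<Longrightarrow> cinner (x - p) w = 0"
      using orthogonal_projection_exists[OF K] by blast
    obtain y where y: "y \<in> N" "norm y = norm p" "\<forall>b\<in>B. cinner y (f b) = cinner p b"
      using isometric_partner[OF K(1) N B(1) B'(1) f p(1)] by auto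
    have "(norm x)\<^sup>2 = (norm (x - p))\<^sup>2 + (norm p)\<^sup>2"
      using norm_add_orthogonal[OF p(2)[OF p(1)]] by simp
    then have "(norm p)\<^sup>2 \<le> (norm x)\<^sup>2" by simp
    then have "norm p \<le> norm x" by (rule power2_le_imp_le) simp
    moreover have "cinner p b = cinner x b" if "b \<in> B" for b
    proof -
      have "b \<in> K" using that BK by blast
      then show ?thesis using p(2)[of b] by (simp add: cinner_diff_left)
    qed
    ultimately show ?thesis using y by (intro bexI[of _ y]) auto
  qed
  have "\<exists>U. \<forall>x. U x \<in> N \<and> norm (U x) \<le> norm x \<and> (\<forall>b\<in>B. cinner (U x) (f b) = cinner x b)"
    by (rule choice) (use partner in auto)
  then obtain U where U: "\<And>x. U x \<in> N" "\<And>x. norm (U x) \<le> norm x"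
    "\<And>x b. b \<in> B \<Longrightarrow> cinner (U x) (f b) = cinner x b" by auto
  have eqI: "U x = y" if "y \<in> N" "\<And>b. b \<in> B \<Longrightarrow> cinner y (f b) = cinner x b" for x y
  proof -
    have "U x - y = 0"
    proof (rule orthonormal_basis_total[OF B'(1)])
      show "U x - y \<in> N" using U(1) that(1) by (rule complex_vector.subspace_diff[OF N(1)])
      fix b' assume "b' \<in> B'"
      then obtain b where "b \<in> B" "b' = f b" using f by (auto simp: bij_betw_def)
      then show "cinner (U x - y) b' = 0" using U(3) that(2) by (simp add: cinner_diff_left)
    qed
    then show ?thesis by simp
  qed
  have add: "U (x + y) = U x + U y" for x y
    by (rule eqI) (simp_all add: complex_vector.subspace_add[OF N(1)] U cinner_add_left)
  have scale: "U (c *\<^sub>C x) = c *\<^sub>C U x" for c x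
    by (rule eqI) (simp_all add: complex_vector.subspace_scale[OF N(1)] U cinner_scaleC_left)
  show ?thesis
  proof (intro exI[of _ U] conjI allI impI ballI)
    show "U \<in> bounded_ops H L" if "N \<subseteq> L" for H :: "'a set" and L
      unfolding bounded_ops_def using that U(1,2) add scale by (auto intro!: exI[of _ 1])
    show "U x \<in> N" for x by (rule U)
    show "x = 0" if x: "x \<in> K" "U x = 0" for x
      by (rule orthonormal_basis_total[OF B(1) x(1)]) (use U(3)[of _ x] x(2) in simp)
    show "\<exists>x\<in>K. U x = y" if y: "y \<in> N" for y
    proof -
      have inv: "bij_betw (the_inv_into B f) B' B" by (rule bij_betw_the_inv_into[OF f])
      obtain x where x: "x \<in> K" "\<forall>b'\<in>B'. cinner x (the_inv_into B f b') = cinner y b'"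
        using isometric_partner[OF N(1) K B'(1) B(1) inv y] by auto
      have "cinner y (f b) = cinner x b" if "b \<in> B" for b
      proof -
        have "the_inv_into B f (f b) = b"
          using f that by (auto simp: bij_betw_def the_inv_into_f_f)
        moreover have "f b \<in> B'" using f that by (auto simp: bij_betw_def)
        ultimately show ?thesis using x(2) by force
      qed
      then show ?thesis using eqI[OF y] x(1) by blast
    qed
    show "U (x + y) = U x" if "\<forall>k\<in>K. cinner y k = 0" for x y
      by (rule eqI) (use U that BK in \<open>auto simp: cinner_add_left\<close>)
  qed
qed

section \<open>The direct sum\<close>

lemma lookup_scaleC: "Poly_Mapping.lookup (c *\<^sub>C x) i = c *\<^sub>C Poly_Mapping.lookup x i"
  by transfer simp

lemma lookup_scaleR: "Poly_Mapping.lookup (r *\<^sub>R x) i = r *\<^sub>R Poly_Mapping.lookup x i"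
  by (simp add: scaleR_scaleC lookup_scaleC)

lemma scaleC_zero_right [simp]: "c *\<^sub>C 0 = (0 :: 'a::complex_inner)"
  by (rule complex_vector.scale_zero_right)

lemma single_scaleC: "Poly_Mapping.single i (c *\<^sub>C z) = c *\<^sub>C Poly_Mapping.single i z"
  by (rule poly_mapping_eqI) (simp add: lookup_scaleC lookup_single when_def)

lemma single_scaleR: "Poly_Mapping.single i (r *\<^sub>R z) = r *\<^sub>R Poly_Mapping.single i z"
  by (simp add: scaleR_scaleC single_scaleC)

lemma norm_power2_poly_mapping:
  "(norm x)\<^sup>2 = (\<Sum>i\<in>Poly_Mapping.keys x. (norm (Poly_Mapping.lookup x i))\<^sup>2)"
  by (simp add: power2_norm_eq_inner inner_eq_Re_cinner cinner_poly_mapping_def)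

lemma norm_lookup_le: "norm (Poly_Mapping.lookup x i) \<le> norm x"
proof (cases "i \<in> Poly_Mapping.keys x")
  case True
  then have "(norm (Poly_Mapping.lookup x i))\<^sup>2 \<le> (norm x)\<^sup>2"
    unfolding norm_power2_poly_mapping
    by (intro member_le_sum[where f = "\<lambda>i. (norm (Poly_Mapping.lookup x i))\<^sup>2"]) auto
  then show ?thesis by (rule power2_le_imp_le) simp
qed (simp add: in_keys_iff)

lemma norm_single [simp]: "norm (Poly_Mapping.single i z) = norm z"
proof (cases "z = 0")
  case False
  then have "(norm (Poly_Mapping.single i z))\<^sup>2 = (norm z)\<^sup>2"
    unfolding norm_power2_poly_mapping by simp
  then show ?thesis by (simp add: power2_eq_iff_nonneg)
qed simp

lemma bounded_linear_lookup: "bounded_linear (\<lambda>x. Poly_Mapping.lookup x i)"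
  by (rule bounded_linear_intro[of _ 1]) (simp_all add: lookup_add lookup_scaleR norm_lookup_le)

lemma bounded_linear_single: "bounded_linear (Poly_Mapping.single i)"
  by (rule bounded_linear_intro[of _ 1]) (simp_all add: single_add single_scaleR)

lemma lookup_sum_single:
  assumes "finite I"
  shows "Poly_Mapping.lookup (\<Sum>i\<in>I. Poly_Mapping.single i (z i)) j = (if j \<in> I then z j else 0)"
proof -
  have "Poly_Mapping.lookup (\<Sum>i\<in>I. Poly_Mapping.single i (z i)) j = (\<Sum>i\<in>I. if i = j then z i else 0)"
    by (simp add: lookup_sum lookup_single when_def)
  then show ?thesis using assms by simp
qed

locale hilbert_family =
  fixes n :: nat and H :: "nat \<Rightarrow> 'a::complex_inner set"
  assumes hilbert: "s \<in> {1..n} \<Longrightarrow> hilbert_space (H s)"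
begin

lemmas csubspace_H = hilbert_spaceD(1)[OF hilbert] and complete_H = hilbert_spaceD(2)[OF hilbert]

abbreviation "G \<equiv> direct_sum n H"

lemma direct_sum_expand:
  assumes "x \<in> G"
  shows "x = (\<Sum>i\<in>{1..n}. Poly_Mapping.single i (Poly_Mapping.lookup x i))"
  by (rule poly_mapping_eqI) (use assms in \<open>auto simp: lookup_sum_single direct_sum_def\<close>)

lemma sum_single_direct_sum:
  assumes "\<And>i. i \<in> {1..n} \<Longrightarrow> z i \<in> H i"
  shows "(\<Sum>i\<in>{1..n}. Poly_Mapping.single i (z i)) \<in> G"
  using assms by (auto simp: direct_sum_def lookup_sum_single)

lemma lookup_direct_sum: "x \<in> G \<Longrightarrow> i \<in> {1..n} \<Longrightarrow> Poly_Mapping.lookup x i \<in> H i"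
  by (simp add: direct_sum_def)

lemma single_direct_sum: "i \<in> {1..n} \<Longrightarrow> z \<in> H i \<Longrightarrow> Poly_Mapping.single i z \<in> G"
  using complex_vector.subspace_0[OF csubspace_H]
  by (auto simp: direct_sum_def lookup_single when_def)

lemma norm_direct_sum_le:
  assumes "x \<in> G"
  shows "norm x \<le> (\<Sum>i\<in>{1..n}. norm (Poly_Mapping.lookup x i))"
proof -
  have "norm x = norm (\<Sum>i\<in>{1..n}. Poly_Mapping.single i (Poly_Mapping.lookup x i))"
    using direct_sum_expand[OF assms] by simp
  also have "\<dots> \<le> (\<Sum>i\<in>{1..n}. norm (Poly_Mapping.single i (Poly_Mapping.lookup x i)))"
    by (rule norm_sum)
  finally show ?thesis by simp
qed

lemma csubspace_direct_sum: "csubspace G"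
  by (rule complex_vector.subspaceI)
    (auto simp: direct_sum_def lookup_add lookup_scaleC complex_vector.subspace_0[OF csubspace_H]
      complex_vector.subspace_add[OF csubspace_H] complex_vector.subspace_scale[OF csubspace_H])

lemma hilbert_space_direct_sum: "hilbert_space G"
  unfolding hilbert_space_def
proof
  show "csubspace G" by (rule csubspace_direct_sum)
  show "complete G"
    unfolding complete_def
  proof (intro allI impI, elim conjE)
    fix f assume f: "\<forall>k. f k \<in> G" "Cauchy f"
    have "\<exists>l. l \<in> H i \<and> (\<lambda>k. Poly_Mapping.lookup (f k) i) \<longlonglongrightarrow> l" if i: "i \<in> {1..n}" for i
    proof -
      have "Cauchy (\<lambda>k. Poly_Mapping.lookup (f k) i)"
        by (rule bounded_linear.Cauchy[OF bounded_linear_lookup f(2)])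
      moreover have "\<forall>k. Poly_Mapping.lookup (f k) i \<in> H i" using f(1) i lookup_direct_sum by blast
      ultimately show ?thesis
        using spec[OF complete_H[OF i, unfolded complete_def], of "\<lambda>k. Poly_Mapping.lookup (f k) i"] by auto
    qed
    then obtain l where l: "\<And>i. i \<in> {1..n} \<Longrightarrow> l i \<in> H i"
      "\<And>i. i \<in> {1..n} \<Longrightarrow> (\<lambda>k. Poly_Mapping.lookup (f k) i) \<longlonglongrightarrow> l i" by metis
    define L where "L = (\<Sum>i\<in>{1..n}. Poly_Mapping.single i (l i))"
    have "L \<in> G" unfolding L_def by (rule sum_single_direct_sum) (rule l)
    have "(\<lambda>k. \<Sum>i\<in>{1..n}. Poly_Mapping.single i (Poly_Mapping.lookup (f k) i)) \<longlonglongrightarrow> L"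
      unfolding L_def by (intro tendsto_sum bounded_linear.tendsto[OF bounded_linear_single] l)
    moreover have "(\<Sum>i\<in>{1..n}. Poly_Mapping.single i (Poly_Mapping.lookup (f k) i)) = f k" for k
      using direct_sum_expand f(1) by metis
    ultimately have "f \<longlonglongrightarrow> L" by simp
    then show "\<exists>l\<in>G. f \<longlonglongrightarrow> l" using \<open>L \<in> G\<close> by blast
  qed
qed

lemma clinear_on_lookup: "clinear_on V (\<lambda>x. Poly_Mapping.lookup x i)"
  by (auto simp: clinear_on_def lookup_add lookup_scaleC)

lemma clinear_on_single: "clinear_on V (Poly_Mapping.single i)"
  by (auto simp: clinear_on_def single_add single_scaleC)

end

section \<open>Upper triangular block operators\<close>

locale triangular_block_operator = hilbert_family +
  fixes D :: "nat \<Rightarrow> 'a \<Rightarrow> 'a" and A :: "nat \<Rightarrow> nat \<Rightarrow> 'a \<Rightarrow> 'a"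
  assumes D: "s \<in> {1..n} \<Longrightarrow> D s \<in> bounded_ops (H s) (H s)"
    and A: "A \<in> upper_tuples n H"
begin

abbreviation "T \<equiv> block_operator n D A"

lemma block_entry_bounded:
  assumes "i \<in> {1..n}" "j \<in> {1..n}"
  shows "block_entry D A i j \<in> bounded_ops (H j) (H i)"
proof -
  have "(\<lambda>_. 0) \<in> bounded_ops (H j) (H i)"
    using complex_vector.subspace_0[OF csubspace_H[OF assms(1)]]
    by (auto simp: bounded_ops_def intro!: exI[of _ 0])
  then show ?thesis
    using D[OF assms(1)] A assms by (auto simp: block_entry_def upper_tuples_def)
qed

lemma lookup_block_operator:
  "Poly_Mapping.lookup (T x) i =
    (if i \<in> {1..n} then \<Sum>j\<in>{1..n}. block_entry D A i j (Poly_Mapping.lookup x j) else 0)"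
  by (simp add: block_operator.rep_eq)

lemma block_operator_bounded: "T \<in> bounded_ops G G"
proof -
  have mem: "T x \<in> G" if "x \<in> G" for x
    using that
    by (auto simp: direct_sum_def lookup_block_operator
        intro!: complex_vector.subspace_sum[OF csubspace_H] bounded_ops_mem[OF block_entry_bounded])
  have add: "T (x + y) = T x + T y" if xy: "x \<in> G" "y \<in> G" for x y
  proof (rule poly_mapping_eqI)
    fix i
    have "block_entry D A i j (Poly_Mapping.lookup x j + Poly_Mapping.lookup y j) =
        block_entry D A i j (Poly_Mapping.lookup x j) + block_entry D A i j (Poly_Mapping.lookup y j)"
      if "i \<in> {1..n}" "j \<in> {1..n}" for j
      using clinear_on_add[OF csubspace_H[OF that(2)] bounded_ops_clinear_on[OF block_entry_bounded[OF that]]]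
        xy that lookup_direct_sum by blast
    then show "Poly_Mapping.lookup (T (x + y)) i = Poly_Mapping.lookup (T x + T y) i"
      by (simp add: lookup_block_operator lookup_add sum.distrib)
  qed
  have scale: "T (c *\<^sub>C x) = c *\<^sub>C T x" if x: "x \<in> G" for c x
  proof (rule poly_mapping_eqI)
    fix i
    have "block_entry D A i j (c *\<^sub>C Poly_Mapping.lookup x j) =
        c *\<^sub>C block_entry D A i j (Poly_Mapping.lookup x j)"
      if "i \<in> {1..n}" "j \<in> {1..n}" for j
      using clinear_on_scaleC[OF csubspace_H[OF that(2)] bounded_ops_clinear_on[OF block_entry_bounded[OF that]]]
        x that lookup_direct_sum by blast
    then show "Poly_Mapping.lookup (T (c *\<^sub>C x)) i = Poly_Mapping.lookup (c *\<^sub>C T x) i"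
      by (simp add: lookup_block_operator lookup_scaleC complex_vector.scale_sum_right)
  qed
  have "\<exists>M\<ge>0. \<forall>x\<in>H j. norm (block_entry D A i j x) \<le> M * norm x"
    if "i \<in> {1..n}" "j \<in> {1..n}" for i j
    by (rule bounded_opsE[OF block_entry_bounded[OF that]]) auto
  then obtain M where M: "\<And>i j. i \<in> {1..n} \<Longrightarrow> j \<in> {1..n} \<Longrightarrow> M i j \<ge> 0"
    "\<And>i j x. i \<in> {1..n} \<Longrightarrow> j \<in> {1..n} \<Longrightarrow> x \<in> H j \<Longrightarrow> norm (block_entry D A i j x) \<le> M i j * norm x"
    by metis
  have "norm (T x) \<le> (\<Sum>i\<in>{1..n}. \<Sum>j\<in>{1..n}. M i j) * norm x" if x: "x \<in> G" for x
  proof -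
    have "norm (T x) \<le> (\<Sum>i\<in>{1..n}. norm (Poly_Mapping.lookup (T x) i))"
      by (rule norm_direct_sum_le[OF mem[OF x]])
    also have "\<dots> \<le> (\<Sum>i\<in>{1..n}. \<Sum>j\<in>{1..n}. M i j * norm x)"
    proof (rule sum_mono)
      fix i assume i: "i \<in> {1..n}"
      have "norm (Poly_Mapping.lookup (T x) i)
          \<le> (\<Sum>j\<in>{1..n}. norm (block_entry D A i j (Poly_Mapping.lookup x j)))"
        using i by (simp add: lookup_block_operator norm_sum)
      also have "\<dots> \<le> (\<Sum>j\<in>{1..n}. M i j * norm x)"
      proof (rule sum_mono)
        fix j assume j: "j \<in> {1..n}"
        have "norm (block_entry D A i j (Poly_Mapping.lookup x j)) \<le> M i j * norm (Poly_Mapping.lookup x j)"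
          by (rule M(2)[OF i j lookup_direct_sum[OF x j]])
        also have "\<dots> \<le> M i j * norm x" by (rule mult_left_mono[OF norm_lookup_le M(1)[OF i j]])
        finally show "norm (block_entry D A i j (Poly_Mapping.lookup x j)) \<le> M i j * norm x" .
      qed
      finally show "norm (Poly_Mapping.lookup (T x) i) \<le> (\<Sum>j\<in>{1..n}. M i j * norm x)" .
    qed
    finally show ?thesis by (simp add: sum_distrib_right)
  qed
  then show ?thesis using mem add scale unfolding bounded_ops_def by auto
qed

lemmas clinear_on_T = bounded_ops_clinear_on[OF block_operator_bounded]

lemma D_zero: "i \<in> {1..n} \<Longrightarrow> D i 0 = 0"
  using clinear_on_zero[OF csubspace_H bounded_ops_clinear_on[OF D]] by simp

text \<open>
Triangularity in the form used throughout: in the last position where a vector may be nonzero, the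
operator acts by its diagonal entry alone.
\<close>

lemma lookup_T_last:
  assumes x: "x \<in> G" and i: "i \<in> {1..n}" and zero: "\<And>j. j > i \<Longrightarrow> Poly_Mapping.lookup x j = 0"
  shows "Poly_Mapping.lookup (T x) i = D i (Poly_Mapping.lookup x i)"
proof -
  have "block_entry D A i j (Poly_Mapping.lookup x j) = (if j = i then D i (Poly_Mapping.lookup x i) else 0)"
    if j: "j \<in> {1..n}" for j
  proof -
    have "block_entry D A i j 0 = 0"
      by (rule clinear_on_zero[OF csubspace_H[OF j] bounded_ops_clinear_on[OF block_entry_bounded[OF i j]]])
    then show ?thesis using zero[of j] by (cases "j < i") (auto simp: block_entry_def)
  qed
  then show ?thesis using i by (simp add: lookup_block_operator)
qed

text \<open>
The sum of the first \<open>m\<close> summands, an invariant subspace of \<open>T\<close>. Restricting \<open>T\<close> to it plays the role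
of the leading \<open>m \<times> m\<close> corner.
\<close>

definition head :: "nat \<Rightarrow> (nat \<Rightarrow>\<^sub>0 'a) set"
  where "head m = {x \<in> G. \<forall>j>m. Poly_Mapping.lookup x j = 0}"

lemma csubspace_head: "csubspace (head m)"
  by (rule complex_vector.subspaceI)
    (auto simp: head_def lookup_add lookup_scaleC complex_vector.subspace_0[OF csubspace_direct_sum]
      complex_vector.subspace_add[OF csubspace_direct_sum]
      complex_vector.subspace_scale[OF csubspace_direct_sum])

lemma head_subset: "head m \<subseteq> G" by (auto simp: head_def)

lemma head_mono: "m \<le> k \<Longrightarrow> head m \<subseteq> head k" by (auto simp: head_def)

lemma head_full: "head n = G" by (auto simp: head_def direct_sum_def)

lemma head_0: "head 0 = {0}"
proof -
  have "x = 0" if x: "x \<in> head 0" for x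
  proof (rule poly_mapping_eqI)
    fix k
    show "Poly_Mapping.lookup x k = Poly_Mapping.lookup 0 k"
      using x by (cases "k = 0") (auto simp: head_def direct_sum_def)
  qed
  then show ?thesis using complex_vector.subspace_0[OF csubspace_head] by blast
qed

lemma single_head: "m \<in> {1..n} \<Longrightarrow> z \<in> H m \<Longrightarrow> Poly_Mapping.single m z \<in> head m"
  using single_direct_sum by (auto simp: head_def lookup_single)

lemma T_G: "x \<in> G \<Longrightarrow> T x \<in> G"
  by (rule bounded_ops_mem[OF block_operator_bounded])

lemma T_head:
  assumes x: "x \<in> head m"
  shows "T x \<in> head m"
proof -
  have xG: "x \<in> G" using x head_subset by blast
  have "Poly_Mapping.lookup (T x) j = 0" if "j > m" for j
  proof (cases "j \<in> {1..n}")
    case True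
    then show ?thesis using lookup_T_last[OF xG True] x that D_zero by (auto simp: head_def)
  qed (simp only: lookup_block_operator if_False)
  then show ?thesis using T_G[OF xG] by (simp add: head_def)
qed

lemma lookup_T_head: "x \<in> head m \<Longrightarrow> m \<in> {1..n} \<Longrightarrow> Poly_Mapping.lookup (T x) m = D m (Poly_Mapping.lookup x m)"
  by (rule lookup_T_last) (auto simp: head_def)

lemma T_diff: "x \<in> G \<Longrightarrow> y \<in> G \<Longrightarrow> T (x - y) = T x - T y"
  by (rule clinear_on_diff[OF csubspace_direct_sum clinear_on_T])

lemma clinear_on_T_head: "clinear_on (head m) T"
  by (rule clinear_on_subset[OF clinear_on_T head_subset])

lemma csubspace_T_head: "csubspace (T ` head m)"
  by (rule csubspace_image[OF csubspace_head clinear_on_T_head])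

lemma csubspace_range_D: "i \<in> {1..n} \<Longrightarrow> csubspace (op_range (H i) (D i))"
  by (rule csubspace_op_range[OF hilbert D])

text \<open>
Back substitution from the last row upwards: up to finitely many dimensions the last component of a
vector is some \<open>D\<^sub>m z\<close>, and subtracting the image of \<open>z\<close> leaves a vector of the smaller corner.
\<close>

lemma finite_over_T_head:
  assumes "m \<le> n" and "\<And>i. i \<in> {1..m} \<Longrightarrow> finite_over (H i) (op_range (H i) (D i))"
  shows "finite_over (head m) (T ` head m)"
  using assms
proof (induction m)
  case 0
  show ?case
    using clinear_on_zero[OF csubspace_head clinear_on_T_head] by (intro finite_over_self) (force simp: head_0)
next
  case (Suc m)
  let ?V = "head (Suc m)" and ?R = "op_range (H (Suc m)) (D (Suc m))"
  let ?V' = "{x \<in> ?V. Poly_Mapping.lookup x (Suc m) \<in> ?R}"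
  let ?Q = "{v + w | v w. v \<in> head m \<and> w \<in> T ` ?V}"
  have m: "Suc m \<in> {1..n}" using Suc.prems by simp
  have "finite_over (head m) (T ` head m)" using Suc by auto
  then have "finite_over (head m) (T ` ?V)"
    using head_mono[of m "Suc m"] by (elim finite_over_mono) auto
  then have Q: "finite_over ?Q (T ` ?V)"
    by (rule finite_over_sum[OF csubspace_head csubspace_T_head])
  have "finite_over ?V ?V'"
    by (rule finite_over_vimage[OF csubspace_head clinear_on_lookup csubspace_range_D[OF m]])
      (use Suc.prems lookup_direct_sum[OF _ m] head_subset in auto)
  moreover have "?V' \<subseteq> ?Q"
  proof
    fix x assume "x \<in> ?V'"
    then obtain z where x: "x \<in> ?V" and z: "z \<in> H (Suc m)" "Poly_Mapping.lookup x (Suc m) = D (Suc m) z"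
      by auto
    let ?e = "Poly_Mapping.single (Suc m) z"
    have e: "?e \<in> ?V" by (rule single_head[OF m z(1)])
    then have Te: "T ?e \<in> ?V" by (rule T_head)
    have "Poly_Mapping.lookup (x - T ?e) (Suc m) = 0"
      using lookup_T_head[OF e m] z by (simp add: lookup_minus)
    moreover have "x - T ?e \<in> ?V" by (rule complex_vector.subspace_diff[OF csubspace_head x Te])
    ultimately have "x - T ?e \<in> head m"
      unfolding head_def by (auto dest: Suc_lessI)
    then show "x \<in> ?Q" using e by (intro CollectI exI[of _ "x - T ?e"] exI[of _ "T ?e"]) auto
  qed
  ultimately have VQ: "finite_over ?V ?Q" by (rule finite_over_mono)
  have "?Q \<subseteq> ?V"
    using head_mono[of m "Suc m"] T_head complex_vector.subspace_add[OF csubspace_head] by auto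
  then show ?case by (rule finite_over_trans[OF VQ Q])
qed

text \<open>
For \<open>z\<close> in the kernel of \<open>D\<^sub>s\<close>, the image under \<open>T\<close> of \<open>z\<close> in position \<open>s\<close> lies in the first \<open>s - 1\<close>
summands. Up to finitely many dimensions it is \<open>T w\<close> with \<open>w\<close> in these summands, and then
\<open>z - w\<close> lies in the kernel of \<open>T\<close> and has \<open>s\<close>-th component \<open>z\<close>.
\<close>

lemma finite_dim_kernel_D:
  assumes ker: "finite_dim (op_kernel G T)" and s: "s \<in> {1..n}"
    and fin: "\<And>i. i \<in> {1..<s} \<Longrightarrow> finite_over (H i) (op_range (H i) (D i))"
  shows "finite_dim (op_kernel (H s) (D s))"
proof -
  let ?K = "op_kernel (H s) (D s)" and ?E = "head (s - 1)"
  let ?f = "\<lambda>z. T (Poly_Mapping.single s z)"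
  let ?Z = "{z \<in> ?K. ?f z \<in> T ` ?E}" and ?Q = "(\<lambda>x. Poly_Mapping.lookup x s) ` op_kernel G T"
  have K: "csubspace ?K" by (rule csubspace_op_kernel[OF hilbert[OF s] D[OF s]])
  have KG: "Poly_Mapping.single s z \<in> G" if "z \<in> ?K" for z
    using that single_direct_sum[OF s] by (simp add: op_kernel_def)
  have f: "clinear_on ?K ?f"
  proof (rule clinear_onI)
    show "?f (x + y) = ?f x + ?f y" if "x \<in> ?K" "y \<in> ?K" for x y
      using clinear_on_add[OF csubspace_direct_sum clinear_on_T KG[OF that(1)] KG[OF that(2)]]
      by (simp add: single_add)
    show "?f (c *\<^sub>C x) = c *\<^sub>C ?f x" if "x \<in> ?K" for c x
      using clinear_on_scaleC[OF csubspace_direct_sum clinear_on_T KG[OF that]]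
      by (simp add: single_scaleC)
  qed
  have fE: "?f z \<in> ?E" if z: "z \<in> ?K" for z
  proof -
    have e: "Poly_Mapping.single s z \<in> head s" using single_head[OF s] z by (simp add: op_kernel_def)
    have "Poly_Mapping.lookup (?f z) s = 0"
      using lookup_T_head[OF e s] z by (simp add: op_kernel_def)
    moreover have "?f z \<in> head s" by (rule T_head[OF e])
    moreover have "j = s \<or> j > s" if "j > s - 1" for j using that by auto
    ultimately show ?thesis unfolding head_def by blast
  qed
  have "finite_over ?E (T ` ?E)" by (rule finite_over_T_head) (use s fin in auto)
  then have KZ: "finite_over ?K ?Z"
    by (rule finite_over_vimage[OF K f csubspace_T_head]) (use fE in auto)
  have kerT: "csubspace (op_kernel G T)"
    by (rule csubspace_op_kernel[OF hilbert_space_direct_sum block_operator_bounded])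
  have "finite_over ?Q ((\<lambda>x. Poly_Mapping.lookup x s) ` {0})"
    by (rule finite_over_image[OF kerT clinear_on_lookup ker])
      (use complex_vector.subspace_0[OF kerT] in simp)
  then have Q: "finite_dim ?Q" by simp
  have Z: "csubspace ?Z" by (rule csubspace_vimage[OF K f csubspace_T_head])
  have "?Z \<subseteq> ?Q"
  proof
    fix z assume "z \<in> ?Z"
    then obtain w where z: "z \<in> ?K" and w: "w \<in> ?E" "?f z = T w" by auto
    have wG: "w \<in> G" using w(1) head_subset by blast
    have "Poly_Mapping.single s z - w \<in> op_kernel G T"
      using T_diff[OF KG[OF z] wG] w(2) complex_vector.subspace_diff[OF csubspace_direct_sum KG[OF z] wG]
      by (simp add: op_kernel_def)
    moreover have "Poly_Mapping.lookup (Poly_Mapping.single s z - w) s = z"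
      using w(1) s by (simp add: head_def lookup_minus)
    ultimately show "z \<in> ?Q" by force
  qed
  then have "finite_dim ?Z" by (rule finite_dim_subspace[OF Q Z])
  then show ?thesis by (rule finite_over_trans[OF KZ]) auto
qed

text \<open>
The kernel of the rows below row \<open>s\<close>, cut down to vectors supported in the first \<open>m\<close> summands. For
\<open>s = 0\<close> and \<open>m = n\<close> this is the kernel of \<open>T\<close>; as \<open>m\<close> decreases to \<open>s\<close>, one component after the
other is trimmed off.
\<close>

definition tail_kernel :: "nat \<Rightarrow> nat \<Rightarrow> (nat \<Rightarrow>\<^sub>0 'a) set"
  where "tail_kernel s m = {x \<in> head m. T x \<in> head s}"

lemma csubspace_tail_kernel: "csubspace (tail_kernel s m)"
  unfolding tail_kernel_def by (rule csubspace_vimage[OF csubspace_head clinear_on_T_head csubspace_head])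

text \<open>
The last component of a vector of \<open>tail_kernel s (Suc m)\<close> lies in the kernel of \<open>D\<^sub>m\<^sub>+\<^sub>1\<close>, so requiring
it to vanish costs only finitely many dimensions.
\<close>

lemma finite_over_tail_kernel:
  assumes "s \<le> m" "m \<le> n"
    and "\<And>i. i \<in> {s<..m} \<Longrightarrow> finite_dim (op_kernel (H i) (D i))"
  shows "finite_over (tail_kernel s m) (tail_kernel s s)"
  using assms
proof (induction m rule: dec_induct)
  case base
  show ?case by (rule finite_over_self) simp
next
  case (step m)
  let ?V = "tail_kernel s (Suc m)"
  have m: "Suc m \<in> {1..n}" using step by simp
  have "Poly_Mapping.lookup x (Suc m) \<in> op_kernel (H (Suc m)) (D (Suc m))" if x: "x \<in> ?V" for x
    using lookup_T_head[OF _ m, of x] x step.hyps lookup_direct_sum[OF _ m]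
    by (auto simp: tail_kernel_def op_kernel_def head_def)
  then have "finite_over ?V {x \<in> ?V. Poly_Mapping.lookup x (Suc m) \<in> {0}}"
    using step by (intro finite_over_vimage[OF csubspace_tail_kernel clinear_on_lookup,
          where U = "op_kernel (H (Suc m)) (D (Suc m))"]) auto
  moreover have "{x \<in> ?V. Poly_Mapping.lookup x (Suc m) \<in> {0}} = tail_kernel s m"
    by (auto simp: tail_kernel_def head_def dest: Suc_lessI)
  ultimately have "finite_over ?V (tail_kernel s m)" by simp
  moreover have "finite_over (tail_kernel s m) (tail_kernel s s)" using step by auto
  moreover have "tail_kernel s m \<subseteq> ?V"
    using head_mono[of m "Suc m"] by (auto simp: tail_kernel_def)
  ultimately show ?case by (rule finite_over_trans)
qed

lemma finite_dim_kernel_T: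
  assumes "\<And>i. i \<in> {1..n} \<Longrightarrow> finite_dim (op_kernel (H i) (D i))"
  shows "finite_dim (op_kernel G T)"
proof -
  have "finite_over (tail_kernel 0 n) (tail_kernel 0 0)"
    by (rule finite_over_tail_kernel) (use assms in auto)
  moreover have "tail_kernel 0 n = op_kernel G T"
    by (simp add: tail_kernel_def op_kernel_def head_full head_0)
  moreover have "tail_kernel 0 0 \<subseteq> {0}" by (auto simp: tail_kernel_def head_0)
  ultimately show ?thesis by (auto intro: finite_over_mono)
qed

text \<open>
Up to finitely many dimensions, a vector \<open>h\<close> of \<open>H\<^sub>s\<close>, placed in position \<open>s\<close>, is \<open>T x\<close> for some \<open>x\<close>
in \<open>tail_kernel s n\<close>. Up to finitely many dimensions again, \<open>x\<close> is supported in the first \<open>s\<close>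
summands, where the \<open>s\<close>-th component of \<open>T x\<close> is \<open>D\<^sub>s x\<^sub>s\<close>.
\<close>

lemma finite_codim_range_D:
  assumes ran: "finite_over G (op_range G T)" and s: "s \<in> {1..n}"
    and fin: "\<And>i. i \<in> {s<..n} \<Longrightarrow> finite_dim (op_kernel (H i) (D i))"
  shows "finite_over (H s) (op_range (H s) (D s))"
proof -
  let ?f = "\<lambda>x. Poly_Mapping.lookup (T x) s"
  let ?Z = "{h \<in> H s. Poly_Mapping.single s h \<in> op_range G T}" and ?Q = "?f ` tail_kernel s n"
  have f: "clinear_on V ?f" if "V \<subseteq> G" for V
    using clinear_on_subset[OF clinear_on_T that] by (auto simp: clinear_on_def lookup_add lookup_scaleC)
  have sub: "tail_kernel s n \<subseteq> G" by (auto simp: tail_kernel_def head_def)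
  have "finite_over (H s) ?Z"
    by (rule finite_over_vimage[OF csubspace_H[OF s] clinear_on_single
        csubspace_op_range[OF hilbert_space_direct_sum block_operator_bounded] ran])
      (use single_direct_sum[OF s] in auto)
  moreover have "?Z \<subseteq> ?Q"
  proof
    fix h assume "h \<in> ?Z"
    then obtain x where x: "h \<in> H s" "x \<in> G" "Poly_Mapping.single s h = T x" by auto
    then have "T x \<in> head s" using single_head[OF s] by metis
    then have "x \<in> tail_kernel s n" using x(2) by (simp add: tail_kernel_def head_full)
    moreover have "?f x = h" using x(3)[symmetric] by simp
    ultimately show "h \<in> ?Q" by force
  qed
  ultimately have HQ: "finite_over (H s) ?Q" by (rule finite_over_mono)
  have "finite_over (tail_kernel s n) (tail_kernel s s)"
    by (rule finite_over_tail_kernel) (use s fin in auto)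
  then have "finite_over ?Q (?f ` tail_kernel s s)"
    by (rule finite_over_image[OF csubspace_tail_kernel f[OF sub]])
      (use s head_mono[of s n] in \<open>auto simp: tail_kernel_def\<close>)
  moreover have "?f ` tail_kernel s s \<subseteq> op_range (H s) (D s)"
    using lookup_T_head[OF _ s] lookup_direct_sum[OF _ s] by (auto simp: tail_kernel_def head_def)
  ultimately have "finite_over ?Q (op_range (H s) (D s))" by (rule finite_over_mono)
  moreover have "?Q \<subseteq> H s" using sub T_G lookup_direct_sum[OF _ s] by auto
  ultimately show ?thesis by (rule finite_over_trans[OF HQ])
qed

text \<open>
The range of \<open>D\<^sub>1\<close>, seen in the direct sum, is the image under \<open>T\<close> of \<open>M = H\<^sub>1 + ker T\<close>. This subspace
contains the kernel of \<open>T\<close>, so it remains to see that it is closed. With \<open>q\<close> deleting the first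
component, \<open>M\<close> is the preimage under \<open>q\<close> of the finite-dimensional space \<open>q (ker T)\<close>.
\<close>

lemma closed_range_D1:
  assumes n: "1 \<le> n" and ker: "finite_dim (op_kernel G T)" and ran: "closed (op_range G T)"
  shows "closed (op_range (H 1) (D 1))"
proof -
  have 1: "1 \<in> {1..n}" using n by simp
  let ?K = "op_kernel G T"
  define q where "q x = x - Poly_Mapping.single 1 (Poly_Mapping.lookup x 1)" for x :: "nat \<Rightarrow>\<^sub>0 'a"
  define M where "M = G \<inter> q -` (q ` ?K)"
  have K: "csubspace ?K"
    by (rule csubspace_op_kernel[OF hilbert_space_direct_sum block_operator_bounded])
  have ql: "clinear_on V q" for V
    by (rule clinear_onI)
      (simp_all add: q_def lookup_add single_add lookup_scaleC single_scaleC
        complex_vector.scale_right_diff_distrib)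
  have qK: "csubspace (q ` ?K)" by (rule csubspace_image[OF K ql])
  have "finite_over (q ` ?K) (q ` {0})"
    by (rule finite_over_image[OF K ql ker]) (use complex_vector.subspace_0[OF K] in simp)
  then have "finite_dim (q ` ?K)" by (simp add: q_def)
  then have "closed (q ` ?K)" by (rule finite_dim_closed[OF qK])
  moreover have "continuous_on UNIV q"
    unfolding q_def
    by (intro continuous_intros bounded_linear.continuous_on[OF bounded_linear_single]
        bounded_linear.continuous_on[OF bounded_linear_lookup])
  ultimately have "closed (q -` (q ` ?K))" by (intro closed_vimage)
  then have clM: "closed M"
    unfolding M_def
    using complete_imp_closed[OF hilbert_spaceD(2)[OF hilbert_space_direct_sum]] by (rule closed_Int[rotated])
  have "M = {x \<in> G. q x \<in> q ` ?K}" by (auto simp: M_def)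
  then have csM: "csubspace M" using csubspace_vimage[OF csubspace_direct_sum ql qK] by simp
  have RG: "csubspace (op_range G T)" "complete (op_range G T)"
    using csubspace_op_range[OF hilbert_space_direct_sum block_operator_bounded]
      complete_closed_subset[OF ran op_range_subset[OF hilbert_space_direct_sum block_operator_bounded]
        hilbert_spaceD(2)[OF hilbert_space_direct_sum]] by auto
  obtain C where C: "C \<ge> 0" "\<And>x. x \<in> G \<Longrightarrow> norm (T x) \<le> C * norm x"
    by (rule bounded_opsE[OF block_operator_bounded]) blast
  have "closed (T ` M)"
  proof (rule closed_image_of_saturated[where X = G and Y = "op_range G T" and S = T and K = C])
    show "subspace G" "subspace (op_range G T)" "subspace M"
      using csubspace_direct_sum RG(1) csM by (simp_all add: csubspace_imp_subspace)
    show "T (r *\<^sub>R x) = r *\<^sub>R T x" if "x \<in> G" for r x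
      using clinear_on_scaleC[OF csubspace_direct_sum clinear_on_T that] by (simp add: scaleR_scaleC)
    show "x \<in> M" if "x \<in> G" "T x = 0" for x using that by (auto simp: M_def op_kernel_def)
  qed (use RG clM C hilbert_spaceD(2)[OF hilbert_space_direct_sum]
      clinear_on_add[OF csubspace_direct_sum clinear_on_T] in \<open>auto simp: M_def\<close>)
  moreover have single: "T (Poly_Mapping.single 1 z) = Poly_Mapping.single 1 (D 1 z)" if z: "z \<in> H 1" for z
  proof (rule poly_mapping_eqI)
    fix i :: nat
    have e: "Poly_Mapping.single 1 z \<in> head 1" by (rule single_head[OF 1 z])
    consider "i = 0" | "i = 1" | "i > 1" by linarith
    then show "Poly_Mapping.lookup (T (Poly_Mapping.single 1 z)) i = Poly_Mapping.lookup (Poly_Mapping.single 1 (D 1 z)) i"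
    proof cases
      case 1
      then show ?thesis by (simp add: lookup_block_operator lookup_single)
    next
      case 2
      then show ?thesis using lookup_T_head[OF e \<open>1 \<in> {1..n}\<close>] by simp
    next
      case 3
      then show ?thesis using T_head[OF e] by (simp add: head_def lookup_single)
    qed
  qed
  have "op_range (H 1) (D 1) = Poly_Mapping.single 1 -` (T ` M)"
  proof (intro equalityI subsetI)
    fix y assume "y \<in> op_range (H 1) (D 1)"
    then obtain z where z: "z \<in> H 1" "y = D 1 z" by auto
    have "q (Poly_Mapping.single 1 z) = q 0" by (simp add: q_def)
    then have "Poly_Mapping.single 1 z \<in> M"
      using single_direct_sum[OF 1 z(1)] complex_vector.subspace_0[OF K] unfolding M_def by auto
    then show "y \<in> Poly_Mapping.single 1 -` (T ` M)"
      using single[OF z(1)] z(2) by (metis imageI vimageI)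
  next
    fix y assume "y \<in> Poly_Mapping.single 1 -` (T ` M)"
    then obtain x k where x: "x \<in> G" "k \<in> ?K" "q x = q k" "Poly_Mapping.single 1 y = T x"
      by (auto simp: M_def)
    then have kG: "k \<in> G" "T k = 0" by (auto simp: op_kernel_def)
    let ?z = "Poly_Mapping.lookup x 1 - Poly_Mapping.lookup k 1"
    have z: "?z \<in> H 1"
      using complex_vector.subspace_diff[OF csubspace_H[OF 1]] lookup_direct_sum[OF _ 1] x(1) kG(1) by blast
    have "x - k = Poly_Mapping.single 1 ?z"
      using x(3) by (simp add: q_def single_diff algebra_simps)
    then have "Poly_Mapping.single (1::nat) y = Poly_Mapping.single 1 (D 1 ?z)"
      using T_diff[OF x(1) kG(1)] kG(2) x(4) single[OF z] by simp
    then have "y = D 1 ?z" by (metis lookup_single_eq)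
    then show "y \<in> op_range (H 1) (D 1)" using z by blast
  qed
  moreover have "continuous_on UNIV (Poly_Mapping.single 1 :: 'a \<Rightarrow> nat \<Rightarrow>\<^sub>0 'a)"
    by (rule linear_continuous_on[OF bounded_linear_single])
  ultimately show ?thesis by (simp add: closed_vimage)
qed

end

section \<open>Fredholm completions\<close>

lemma (in triangular_block_operator) Phi_if_diagonal_Fredholm:
  assumes "\<And>s. s \<in> {1..n} \<Longrightarrow> cfinite (alpha (H s) (D s))"
    and "\<And>s. s \<in> {1..n} \<Longrightarrow> cfinite (beta (H s) (D s))"
  shows "T \<in> Phi G"
proof -
  have "finite_dim (op_kernel G T)"
    using assms(1) cfinite_alpha_iff[OF hilbert D] by (intro finite_dim_kernel_T) auto
  moreover have "finite_over (head n) (T ` head n)"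
    using assms(2) cfinite_beta_iff[OF hilbert D] by (intro finite_over_T_head) auto
  ultimately show ?thesis
    by (simp add: Phi_iff[OF hilbert_space_direct_sum block_operator_bounded] head_full)
qed

text \<open>
The index \<open>j\<close> is the least with \<open>\<beta>(D\<^sub>j)\<close> infinite, so that \<open>\<alpha>(D\<^sub>s)\<close> is finite for all \<open>s \<le> j\<close>; the
index \<open>k\<close> is the greatest with \<open>\<alpha>(D\<^sub>k)\<close> infinite, so that \<open>\<beta>(D\<^sub>s)\<close> is finite for all \<open>s \<ge> k\<close>.
\<close>

lemma (in triangular_block_operator) diagonal_of_Fredholm:
  assumes n: "2 \<le> n" and Phi: "T \<in> Phi G"
  shows "(D 1 \<in> Phi_plus (H 1) \<and> D n \<in> Phi_minus (H n)) \<and>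
      ((\<exists>j\<in>{1..n-1}. \<exists>k\<in>{2..n}. j < k \<and>
          cinfinite (beta (H j) (D j)) \<and>
          (\<forall>s\<in>{2..j}. cfinite (alpha (H s) (D s))) \<and>
          cinfinite (alpha (H k) (D k)) \<and>
          (\<forall>s\<in>{k..n-1}. cfinite (beta (H s) (D s)))) \<or>
       (\<forall>j\<in>{2..n}. D j \<in> Phi_plus (H j)) \<and> (\<forall>k\<in>{1..n-1}. D k \<in> Phi_minus (H k)))"
proof -
  have ker: "finite_dim (op_kernel G T)" and ran: "finite_over G (op_range G T)"
    using Phi by (simp_all add: Phi_iff[OF hilbert_space_direct_sum block_operator_bounded])
  have a_iff: "cfinite (alpha (H s) (D s)) \<longleftrightarrow> finite_dim (op_kernel (H s) (D s))"
    and b_iff: "cfinite (beta (H s) (D s)) \<longleftrightarrow> finite_over (H s) (op_range (H s) (D s))"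
    if "s \<in> {1..n}" for s
    using cfinite_alpha_iff[OF hilbert[OF that] D[OF that]] cfinite_beta_iff[OF hilbert[OF that] D[OF that]]
    by auto
  have alpha: "cfinite (alpha (H s) (D s))"
    if "s \<in> {1..n}" "\<And>i. i \<in> {1..<s} \<Longrightarrow> cfinite (beta (H i) (D i))" for s
    using that by (auto simp: a_iff b_iff intro!: finite_dim_kernel_D[OF ker])
  have beta: "cfinite (beta (H s) (D s))"
    if "s \<in> {1..n}" "\<And>i. i \<in> {s<..n} \<Longrightarrow> cfinite (alpha (H i) (D i))" for s
    using that by (auto simp: a_iff b_iff intro!: finite_codim_range_D[OF ran])
  have first: "D 1 \<in> Phi_plus (H 1)"
  proof -
    have "closed (op_range G T)"
      by (rule closed_op_range_of_finite_codim[OF hilbert_space_direct_sum block_operator_bounded ran])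
    then have "closed (op_range (H 1) (D 1))" using n by (intro closed_range_D1[OF _ ker]) auto
    moreover have "cfinite (alpha (H 1) (D 1))" using n by (intro alpha) auto
    ultimately show ?thesis using D[of 1] n by (simp add: Phi_plus_def)
  qed
  have last: "D n \<in> Phi_minus (H n)"
  proof -
    have "cfinite (beta (H n) (D n))" using n by (intro beta) auto
    then show ?thesis using D[of n] n by (simp add: Phi_minus_def)
  qed
  show ?thesis
  proof (cases "\<exists>j\<in>{1..n-1}. cinfinite (beta (H j) (D j))")
    case False
    then have b: "cfinite (beta (H s) (D s))" if "s \<in> {1..n-1}" for s
      using that by (auto simp: cinfinite_iff)
    have bn: "cfinite (beta (H n) (D n))" using last by (simp add: Phi_minus_def)
    have "D s \<in> Phi_plus (H s)" if s: "s \<in> {2..n}" for s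
    proof -
      have s1: "s \<in> {1..n}" using s by auto
      have "cfinite (beta (H s) (D s))" using b[of s] bn s by (cases "s = n") auto
      then have "closed (op_range (H s) (D s))"
        using closed_op_range_of_finite_codim[OF hilbert[OF s1] D[OF s1]] b_iff[OF s1] by blast
      moreover have "cfinite (alpha (H s) (D s))" using s b by (intro alpha) auto
      ultimately show ?thesis using D[OF s1] by (simp add: Phi_plus_def)
    qed
    moreover have "D s \<in> Phi_minus (H s)" if "s \<in> {1..n-1}" for s
      using that b[of s] D[of s] by (auto simp: Phi_minus_def)
    ultimately show ?thesis using first last by blast
  next
    case True
    define P where "P j \<longleftrightarrow> j \<in> {1..n-1} \<and> cinfinite (beta (H j) (D j))" for j
    define j where "j = (LEAST j. P j)"
    have "\<exists>j. P j" using True by (auto simp: P_def)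
    then have Pj: "P j" unfolding j_def by (rule LeastI_ex)
    then have j: "j \<in> {1..n-1}" "cinfinite (beta (H j) (D j))" by (auto simp: P_def)
    have bj: "cfinite (beta (H i) (D i))" if "i \<in> {1..<j}" for i
    proof -
      have "\<not> P i" using not_less_Least[of i P] that by (simp add: j_def)
      then show ?thesis using that j(1) by (auto simp: P_def cinfinite_iff)
    qed
    have aj: "cfinite (alpha (H s) (D s))" if "s \<in> {1..j}" for s
      using that j(1) bj by (intro alpha) auto
    define Q where "Q k \<longleftrightarrow> k \<in> {2..n} \<and> cinfinite (alpha (H k) (D k))" for k
    define k where "k = (GREATEST k. Q k)"
    have Qn: "\<And>y. Q y \<Longrightarrow> y \<le> n" by (simp add: Q_def)
    \<comment> \<open>Otherwise the dual argument, run from \<open>n\<close> down to \<open>j\<close>, would make \<open>\<beta>(D\<^sub>j)\<close> finite.\<close>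
    have "\<exists>k. Q k"
    proof (rule ccontr)
      assume "\<nexists>k. Q k"
      then have "cfinite (alpha (H i) (D i))" if "i \<in> {j<..n}" for i
        using that j(1) by (auto simp: Q_def cinfinite_iff)
      then have "cfinite (beta (H j) (D j))" using j(1) by (intro beta) auto
      then show False using j(2) by (simp add: cinfinite_iff)
    qed
    then have "Q k" unfolding k_def using GreatestI_ex_nat[of Q n] Qn by blast
    then have k: "k \<in> {2..n}" "cinfinite (alpha (H k) (D k))" by (auto simp: Q_def)
    have ak: "cfinite (alpha (H i) (D i))" if "i \<in> {k<..n}" for i
    proof -
      have "\<not> Q i"
      proof
        assume "Q i"
        then have "i \<le> k" unfolding k_def using Qn by (intro Greatest_le_nat[of Q i n]) auto
        then show False using that by simp
      qed
      then show ?thesis using that k(1) by (auto simp: Q_def cinfinite_iff)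
    qed
    have bk: "cfinite (beta (H s) (D s))" if "s \<in> {k..n-1}" for s
      using that k(1) ak by (intro beta) auto
    have "\<not> k \<le> j"
      using aj[of k] k by (auto simp: cinfinite_iff)
    then have "j < k" by simp
    then show ?thesis using first last j k aj bk by (intro conjI disjI1 bexI[of _ j] bexI[of _ k]) auto
  qed
qed

text \<open>
The superdiagonal entry in column \<open>s\<close> is a partial isometry of the kernel \<open>K\<^sub>s\<close> of \<open>D\<^sub>s\<close> onto the
orthogonal complement \<open>N\<^sub>s\<^sub>-\<^sub>1\<close> of the range of \<open>D\<^sub>s\<^sub>-\<^sub>1\<close>. In each row the diagonal and the superdiagonal
contribution are orthogonal, so if their sum vanishes, both do; hence a kernel vector has all
components beyond the first equal to \<open>0\<close>. Conversely \<open>y\<^sub>i = D\<^sub>i u\<^sub>i + w\<^sub>i\<close> with \<open>u\<^sub>i\<close> orthogonal to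
\<open>K\<^sub>i\<close> and \<open>w\<^sub>i\<close> in \<open>N\<^sub>i\<close>; choosing \<open>v\<^sub>i\<^sub>+\<^sub>1\<close> in \<open>K\<^sub>i\<^sub>+\<^sub>1\<close> with image \<open>w\<^sub>i\<close>, the vector with components
\<open>v\<^sub>i + u\<^sub>i\<close> is mapped to \<open>y\<close>, since \<open>D\<^sub>i\<close> does not see \<open>v\<^sub>i\<close> and the partial isometry does not see \<open>u\<^sub>i\<close>.
In the last row only the range of \<open>D\<^sub>n\<close> is reached.
\<close>

lemma staircase_completion:
  fixes H :: "nat \<Rightarrow> 'a::complex_inner set"
  assumes "hilbert_family n H" and n: "2 \<le> n"
    and D: "\<And>s. s \<in> {1..n} \<Longrightarrow> D s \<in> bounded_ops (H s) (H s)"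
    and closed: "\<And>s. s \<in> {1..n-1} \<Longrightarrow> closed (op_range (H s) (D s))"
    and first: "cfinite (alpha (H 1) (D 1))" and last: "cfinite (beta (H n) (D n))"
    and dims: "\<And>s. s \<in> {2..n} \<Longrightarrow> alpha (H s) (D s) =o beta (H (s-1)) (D (s-1))"
  shows "\<exists>A\<in>upper_tuples n H. block_operator n D A \<in> Phi (direct_sum n H)"
proof -
  interpret hilbert_family n H by fact
  define K where "K s = op_kernel (H s) (D s)" for s
  define R where "R s = op_range (H s) (D s)" for s
  define N where "N s = orthogonal_complement (H s) (R s)" for s
  have K: "csubspace (K s)" "complete (K s)" "K s \<subseteq> H s" if "s \<in> {1..n}" for s
    unfolding K_def using csubspace_op_kernel[OF hilbert D] complete_op_kernel[OF hilbert D] that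
    by (auto simp: op_kernel_def)
  have R: "csubspace (R s)" "R s \<subseteq> H s" if "s \<in> {1..n}" for s
    unfolding R_def using csubspace_op_range[OF hilbert D] op_range_subset[OF hilbert D] that by auto
  have N: "csubspace (N s)" "complete (N s)" "N s \<subseteq> H s" if "s \<in> {1..n}" for s
    unfolding N_def
    using csubspace_orthogonal_complement[OF hilbert] complete_orthogonal_complement[OF hilbert] that
    by (auto simp: orthogonal_complement_def)
  define stair where "stair s U \<longleftrightarrow>
      (\<forall>L M. N (s-1) \<subseteq> M \<longrightarrow> U \<in> bounded_ops L M) \<and> (\<forall>x. U x \<in> N (s-1)) \<and>
      (\<forall>x\<in>K s. U x = 0 \<longrightarrow> x = 0) \<and> (\<forall>y\<in>N (s-1). \<exists>x\<in>K s. U x = y) \<and>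
      (\<forall>x y. (\<forall>k\<in>K s. cinner y k = 0) \<longrightarrow> U (x + y) = U x)" for s and U :: "'a \<Rightarrow> 'a"
  have "\<forall>s\<in>{2..n}. \<exists>U. stair s U"
  proof
    fix s assume s: "s \<in> {2..n}"
    have s1: "s \<in> {1..n}" "s - 1 \<in> {1..n}" "s - 1 \<in> {1..n-1}" using s by auto
    have "hilbert_dim (K s) =o hilbert_dim (N (s-1))"
      using dims[OF s] closed[OF s1(3)] by (simp add: alpha_def beta_def K_def N_def R_def)
    then show "\<exists>U. stair s U"
      unfolding stair_def by (rule partial_isometry_exists[OF K(1,2)[OF s1(1)] N(1,2)[OF s1(2)]])
  qed
  from bchoice[OF this] obtain U where U: "\<forall>s\<in>{2..n}. stair s (U s)" by blast
  have UB: "\<And>s L M. s \<in> {2..n} \<Longrightarrow> N (s-1) \<subseteq> M \<Longrightarrow> U s \<in> bounded_ops L M"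
    and UN: "\<And>s x. s \<in> {2..n} \<Longrightarrow> U s x \<in> N (s-1)"
    and Uinj: "\<And>s x. s \<in> {2..n} \<Longrightarrow> x \<in> K s \<Longrightarrow> U s x = 0 \<Longrightarrow> x = 0"
    and Uonto: "\<And>s y. s \<in> {2..n} \<Longrightarrow> y \<in> N (s-1) \<Longrightarrow> \<exists>x\<in>K s. U s x = y"
    and Uperp: "\<And>s x y. s \<in> {2..n} \<Longrightarrow> \<forall>k\<in>K s. cinner y k = 0 \<Longrightarrow> U s (x + y) = U s x"
    using U unfolding stair_def by simp_all
  define A where "A i j = (if j = Suc i then U j else (\<lambda>_. 0))" for i j
  have A: "A \<in> upper_tuples n H"
    unfolding upper_tuples_def
  proof (intro CollectI allI impI, elim conjE)
    fix i j assume ij: "1 \<le> i" "i < j" "j \<le> n"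
    show "A i j \<in> bounded_ops (H j) (H i)"
    proof (cases "j = Suc i")
      case True
      then show ?thesis using UB[of j "H i" "H j"] N(3)[of i] ij by (simp add: A_def)
    next
      case False
      have "0 \<in> H i" using complex_vector.subspace_0[OF csubspace_H[of i]] ij by simp
      then show ?thesis using False by (auto simp: A_def bounded_ops_def intro!: exI[of _ 0])
    qed
  qed
  interpret triangular_block_operator n H D A
    by unfold_locales (use A D in auto)
  have T: "Poly_Mapping.lookup (T x) i =
      D i (Poly_Mapping.lookup x i) + (if i < n then U (Suc i) (Poly_Mapping.lookup x (Suc i)) else 0)"
    if x: "x \<in> G" and i: "i \<in> {1..n}" for x i
  proof -
    let ?J = "if i < n then {i, Suc i} else {i}"
    have "Poly_Mapping.lookup (T x) i = (\<Sum>j\<in>{1..n}. block_entry D A i j (Poly_Mapping.lookup x j))"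
      using i by (simp add: lookup_block_operator)
    also have "\<dots> = (\<Sum>j\<in>?J. block_entry D A i j (Poly_Mapping.lookup x j))"
      using i by (intro sum.mono_neutral_right) (auto simp: block_entry_def A_def)
    also have "\<dots> = D i (Poly_Mapping.lookup x i) + (if i < n then U (Suc i) (Poly_Mapping.lookup x (Suc i)) else 0)"
      by (auto simp: block_entry_def A_def)
    finally show ?thesis .
  qed
  have D_R: "D i z \<in> R i" if "z \<in> H i" for i z using that by (simp add: R_def)
  have split0: "r = 0 \<and> w = 0" if "r \<in> R i" "w \<in> N i" "r + w = 0" for r w i
  proof -
    have "cinner w r = 0" using that by (auto simp: N_def orthogonal_complement_def)
    moreover have "r = - w" using that(3) by (simp add: add_eq_0_iff2)
    ultimately have "cinner r r = 0" using cinner_diff_left[of 0 w r] by simp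
    then show ?thesis using that(3) by simp
  qed
  have "finite_dim (op_kernel G T)"
  proof -
    have ker: "D i (Poly_Mapping.lookup x i) = 0 \<and> (1 < i \<longrightarrow> Poly_Mapping.lookup x i = 0)"
      if x: "x \<in> op_kernel G T" and i: "i \<in> {1..n}" for x i
    proof -
      have xG: "x \<in> G" "T x = 0" using x by (auto simp: op_kernel_def)
      have step: "D i (Poly_Mapping.lookup x i) = 0 \<and> (i < n \<longrightarrow> U (Suc i) (Poly_Mapping.lookup x (Suc i)) = 0)"
        if i: "i \<in> {1..n}" for i
      proof (cases "i < n")
        case True
        then have "D i (Poly_Mapping.lookup x i) + U (Suc i) (Poly_Mapping.lookup x (Suc i)) = 0"
          using T[OF xG(1) i] xG(2) by simp
        then show ?thesis
          using split0[OF D_R[OF lookup_direct_sum[OF xG(1) i]]] UN[of "Suc i" "Poly_Mapping.lookup x (Suc i)"] True i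
          by auto
      next
        case False
        then show ?thesis using T[OF xG(1) i] xG(2) by simp
      qed
      have "Poly_Mapping.lookup x i = 0" if "1 < i"
      proof (rule Uinj[of i])
        show "i \<in> {2..n}" using that i by auto
        show "Poly_Mapping.lookup x i \<in> K i"
          using step[OF i] lookup_direct_sum[OF xG(1) i] by (simp add: K_def op_kernel_def)
        have "i - 1 \<in> {1..n}" "i - 1 < n" "Suc (i - 1) = i" using that i by auto
        then show "U i (Poly_Mapping.lookup x i) = 0" using step[of "i - 1"] by simp
      qed
      then show ?thesis using step[OF i] by blast
    qed
    have 1: "1 \<in> {1..n}" using n by simp
    have csK: "csubspace (op_kernel G T)"
      by (rule csubspace_op_kernel[OF hilbert_space_direct_sum block_operator_bounded])
    have "finite_over (op_kernel G T) {x \<in> op_kernel G T. Poly_Mapping.lookup x 1 \<in> {0}}"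
    proof (rule finite_over_vimage[OF csK clinear_on_lookup])
      show "finite_dim (K 1)" using first cfinite_alpha_iff[OF hilbert[OF 1] D[OF 1]] by (simp add: K_def)
      show "(\<lambda>x. Poly_Mapping.lookup x 1) ` op_kernel G T \<subseteq> K 1"
        using ker[OF _ 1] lookup_direct_sum[OF _ 1] by (auto simp: K_def op_kernel_def)
    qed simp
    moreover have "{x \<in> op_kernel G T. Poly_Mapping.lookup x 1 \<in> {0}} \<subseteq> {0}"
    proof
      fix x assume x: "x \<in> {x \<in> op_kernel G T. Poly_Mapping.lookup x 1 \<in> {0}}"
      have "Poly_Mapping.lookup x i = 0" for i
      proof (cases "i \<in> {1..n}")
        case True
        then show ?thesis using ker[of x i] x by (cases "i = 1") auto
      next
        case False
        then show ?thesis using x by (auto simp: op_kernel_def direct_sum_def)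
      qed
      then show "x \<in> {0}" by (simp add: poly_mapping_eqI)
    qed
    ultimately show ?thesis by (rule finite_over_mono)
  qed
  moreover have "finite_over G (op_range G T)"
  proof -
    have nn: "n \<in> {1..n}" using n by simp
    have "finite_over (H n) (R n)"
      using last cfinite_beta_iff[OF hilbert[OF nn] D[OF nn]] by (simp add: R_def)
    then have "finite_over G {y \<in> G. Poly_Mapping.lookup y n \<in> R n}"
      using lookup_direct_sum[OF _ nn] R[OF nn]
      by (intro finite_over_vimage[OF csubspace_direct_sum clinear_on_lookup]) auto
    moreover have "{y \<in> G. Poly_Mapping.lookup y n \<in> R n} \<subseteq> op_range G T"
    proof
      fix y assume "y \<in> {y \<in> G. Poly_Mapping.lookup y n \<in> R n}"
      then have y: "y \<in> G" "Poly_Mapping.lookup y n \<in> R n" by auto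
      have "\<exists>u w. u \<in> H i \<and> (\<forall>k\<in>K i. cinner u k = 0) \<and> w \<in> N i \<and>
          Poly_Mapping.lookup y i = D i u + w \<and> (i = n \<longrightarrow> w = 0)" if i: "i \<in> {1..n}" for i
      proof -
        have "\<exists>r w. r \<in> R i \<and> w \<in> N i \<and> Poly_Mapping.lookup y i = r + w \<and> (i = n \<longrightarrow> w = 0)"
        proof (cases "i = n")
          case True
          then show ?thesis using y(2) complex_vector.subspace_0[OF N(1)[OF i]]
            by (intro exI[of _ "Poly_Mapping.lookup y n"] exI[of _ 0]) auto
        next
          case False
          then have "closed (R i)" using closed[of i] i by (auto simp: R_def)
          then show ?thesis
            using False orthogonal_decomposition[OF hilbert[OF i] R[OF i] _ lookup_direct_sum[OF y(1) i]]
            unfolding N_def by metis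
        qed
        then obtain r w where rw: "r \<in> R i" "w \<in> N i" "Poly_Mapping.lookup y i = r + w" "i = n \<longrightarrow> w = 0"
          by auto
        then obtain z where z: "z \<in> H i" "r = D i z" by (auto simp: R_def)
        obtain k u where ku: "k \<in> K i" "u \<in> orthogonal_complement (H i) (K i)" "z = k + u"
          by (rule orthogonal_decomposition[OF hilbert[OF i] K(1)[OF i] K(3)[OF i]
                complete_imp_closed[OF K(2)[OF i]] z(1)])
        have "D i z = D i k + D i u"
          using ku K(3)[OF i] clinear_on_add[OF csubspace_H[OF i] bounded_ops_clinear_on[OF D[OF i]], of k u]
          by (auto simp: orthogonal_complement_def)
        then have "r = D i u" using ku(1) z(2) by (simp add: K_def op_kernel_def)
        then show ?thesis using ku(2) rw by (auto simp: orthogonal_complement_def)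
      qed
      then obtain u w where uw: "\<And>i. i \<in> {1..n} \<Longrightarrow> u i \<in> H i"
        "\<And>i. i \<in> {1..n} \<Longrightarrow> \<forall>k\<in>K i. cinner (u i) k = 0" "\<And>i. i \<in> {1..n} \<Longrightarrow> w i \<in> N i"
        "\<And>i. i \<in> {1..n} \<Longrightarrow> Poly_Mapping.lookup y i = D i (u i) + w i" "w n = 0"
        using nn by metis
      have "\<exists>v. v \<in> K i \<and> (1 < i \<longrightarrow> U i v = w (i - 1))" if i: "i \<in> {1..n}" for i
      proof (cases "1 < i")
        case True
        then have "i \<in> {2..n}" "i - 1 \<in> {1..n}" using i by auto
        then show ?thesis using Uonto uw(3) by blast
      next
        case False
        then show ?thesis using complex_vector.subspace_0[OF K(1)[OF i]] by blast
      qed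
      then obtain v where v: "\<And>i. i \<in> {1..n} \<Longrightarrow> v i \<in> K i"
        "\<And>i. i \<in> {1..n} \<Longrightarrow> 1 < i \<Longrightarrow> U i (v i) = w (i - 1)" by metis
      have vH: "v i \<in> H i" "D i (v i) = 0" if "i \<in> {1..n}" for i
        using v(1)[OF that] by (auto simp: K_def op_kernel_def)
      define x where "x = (\<Sum>i\<in>{1..n}. Poly_Mapping.single i (v i + u i))"
      have xG: "x \<in> G"
        unfolding x_def
        by (rule sum_single_direct_sum) (use vH uw(1) complex_vector.subspace_add[OF csubspace_H] in auto)
      have xl: "Poly_Mapping.lookup x i = v i + u i" if "i \<in> {1..n}" for i
        unfolding x_def using that by (simp add: lookup_sum_single)
      have "T x = y"
      proof (rule poly_mapping_eqI)
        fix i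
        show "Poly_Mapping.lookup (T x) i = Poly_Mapping.lookup y i"
        proof (cases "i \<in> {1..n}")
          case True
          have Di: "D i (v i + u i) = D i (u i)"
            using clinear_on_add[OF csubspace_H[OF True] bounded_ops_clinear_on[OF D[OF True]]
                vH(1)[OF True] uw(1)[OF True]] vH(2)[OF True] by simp
          have "(if i < n then U (Suc i) (Poly_Mapping.lookup x (Suc i)) else 0) = w i"
          proof (cases "i < n")
            case True
            then have S: "Suc i \<in> {1..n}" "Suc i \<in> {2..n}" using \<open>i \<in> {1..n}\<close> by auto
            then show ?thesis
              using True xl[OF S(1)] Uperp[OF S(2) uw(2)[OF S(1)]] v(2)[OF S(1)] S(2) by simp
          next
            case False
            then have "i = n" using True by simp
            then show ?thesis using uw(5) by simp
          qed
          then show ?thesis using T[OF xG True] xl[OF True] Di uw(4)[OF True] by simp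
        next
          case False
          then have "Poly_Mapping.lookup y i = 0" using y(1) unfolding direct_sum_def by blast
          then show ?thesis using False by (simp only: lookup_block_operator if_False)
        qed
      qed
      then show "y \<in> op_range G T" using xG by blast
    qed
    ultimately show ?thesis by (rule finite_over_mono)
  qed
  ultimately have "T \<in> Phi G"
    by (simp add: Phi_iff[OF hilbert_space_direct_sum block_operator_bounded])
  then show ?thesis using A by blast
qed

theorem theorem3p15:
  fixes n :: nat
    and H :: "nat \<Rightarrow> 'a::complex_inner set"
    and D :: "nat \<Rightarrow> 'a \<Rightarrow> 'a"
  assumes "2 \<le> n"
    and "\<And>s. s \<in> {1..n} \<Longrightarrow> hilbert_space (H s)"
    and "\<And>s. s \<in> {1..n} \<Longrightarrow> cinfinite (hilbert_dim (H s))"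
    and "\<And>s. s \<in> {1..n} \<Longrightarrow> D s \<in> bounded_ops (H s) (H s)"
  defines "Fredholm_all \<equiv>
      (\<forall>j\<in>{2..n}. D j \<in> Phi_plus (H j)) \<and> (\<forall>k\<in>{1..n-1}. D k \<in> Phi_minus (H k))"
  defines "cond_i \<equiv>
      (D 1 \<in> Phi_plus (H 1) \<and> D n \<in> Phi_minus (H n)) \<and>
      (((\<forall>s\<in>{2..n-1}. closed (op_range (H s) (D s))) \<and>
        ((\<forall>s\<in>{2..n}. alpha (H s) (D s) =o beta (H (s-1)) (D (s-1))) \<or>
         (\<forall>s\<in>{2..n}. alpha (H s) (D s) \<le>o beta (H (s-1)) (D (s-1)) \<and>
                     cfinite (beta (H (s-1)) (D (s-1)))))) \<or>
       Fredholm_all)"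
  defines "cond_ii \<equiv>
      (\<exists>A \<in> upper_tuples n H. block_operator n D A \<in> Phi (direct_sum n H))"
  defines "cond_iii \<equiv>
      (D 1 \<in> Phi_plus (H 1) \<and> D n \<in> Phi_minus (H n)) \<and>
      ((\<exists>j\<in>{1..n-1}. \<exists>k\<in>{2..n}. j < k \<and>
          cinfinite (beta (H j) (D j)) \<and>
          (\<forall>s\<in>{2..j}. cfinite (alpha (H s) (D s))) \<and>
          cinfinite (alpha (H k) (D k)) \<and>
          (\<forall>s\<in>{k..n-1}. cfinite (beta (H s) (D s)))) \<or>
       Fredholm_all)"
  shows "(cond_i \<longrightarrow> cond_ii) \<and> (cond_ii \<longrightarrow> cond_iii)"
proof
  have family: "hilbert_family n H" using assms(2) by (rule hilbert_family.intro)
  interpret hilbert_family n H by (rule family)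
  show "cond_i \<longrightarrow> cond_ii"
  proof
    assume i: cond_i
    then have ends: "D 1 \<in> Phi_plus (H 1)" "D n \<in> Phi_minus (H n)" by (auto simp: cond_i_def)
    have a1: "cfinite (alpha (H 1) (D 1))" and bn: "cfinite (beta (H n) (D n))"
      using ends by (auto simp: Phi_plus_def Phi_minus_def)
    have diagonal: cond_ii
      if "\<And>s. s \<in> {2..n} \<Longrightarrow> cfinite (alpha (H s) (D s))"
        "\<And>s. s \<in> {1..n-1} \<Longrightarrow> cfinite (beta (H s) (D s))"
    proof -
      define A :: "nat \<Rightarrow> nat \<Rightarrow> 'a \<Rightarrow> 'a" where "A i j x = 0" for i j x
      have "A i j \<in> bounded_ops (H j) (H i)" if "i \<in> {1..n}" for i j
        using complex_vector.subspace_0[OF csubspace_H[OF that]]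
        by (auto simp: A_def bounded_ops_def intro!: exI[of _ 0])
      then have A: "A \<in> upper_tuples n H" by (simp add: upper_tuples_def)
      interpret triangular_block_operator n H D A
        by unfold_locales (use A assms(4) in auto)
      have "cfinite (alpha (H s) (D s))" if "s \<in> {1..n}" for s
        using that \<open>\<And>s. s \<in> {2..n} \<Longrightarrow> cfinite (alpha (H s) (D s))\<close>[of s] a1 by (cases "s = 1") auto
      moreover have "cfinite (beta (H s) (D s))" if "s \<in> {1..n}" for s
        using that \<open>\<And>s. s \<in> {1..n-1} \<Longrightarrow> cfinite (beta (H s) (D s))\<close>[of s] bn by (cases "s = n") auto
      ultimately have "T \<in> Phi G" by (rule Phi_if_diagonal_Fredholm)
      then show cond_ii unfolding cond_ii_def using A by blast
    qed
    consider (equal) "\<forall>s\<in>{2..n-1}. closed (op_range (H s) (D s))"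
        "\<forall>s\<in>{2..n}. alpha (H s) (D s) =o beta (H (s-1)) (D (s-1))"
      | (le) "\<forall>s\<in>{2..n}. alpha (H s) (D s) \<le>o beta (H (s-1)) (D (s-1)) \<and>
                     cfinite (beta (H (s-1)) (D (s-1)))"
      | (all) Fredholm_all
      using i unfolding cond_i_def by blast
    then show cond_ii
    proof cases
      case equal
      have "closed (op_range (H s) (D s))" if "s \<in> {1..n-1}" for s
        using that equal(1) ends(1) by (cases "s = 1") (auto simp: Phi_plus_def)
      then show ?thesis
        unfolding cond_ii_def using equal(2) a1 bn assms(1,4)
        by (intro staircase_completion[OF family]) auto
    next
      case le
      \<comment> \<open>A cardinal below a finite one is finite, so again every diagonal entry has finite \<open>\<alpha>\<close> and \<open>\<beta>\<close>.\<close>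
      show ?thesis
      proof (rule diagonal)
        fix s assume s: "s \<in> {2..n}"
        then have "alpha (H s) (D s) \<le>o beta (H (s-1)) (D (s-1))" "cfinite (beta (H (s-1)) (D (s-1)))"
          using le by auto
        then show "cfinite (alpha (H s) (D s))"
          using cinfinite_mono by (auto simp: cinfinite_iff)
      next
        fix s assume "s \<in> {1..n-1}"
        then have "Suc s \<in> {2..n}" by auto
        then show "cfinite (beta (H s) (D s))" using bspec[OF le, of "Suc s"] by simp
      qed
    next
      case all
      then show ?thesis
        by (intro diagonal) (auto simp: Fredholm_all_def Phi_plus_def Phi_minus_def)
    qed
  qed
  show "cond_ii \<longrightarrow> cond_iii"
  proof
    assume cond_ii
    then obtain A where A: "A \<in> upper_tuples n H" and Phi: "block_operator n D A \<in> Phi (direct_sum n H)"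
      unfolding cond_ii_def by blast
    interpret triangular_block_operator n H D A
      by unfold_locales (use A assms(4) in auto)
    show cond_iii
      unfolding cond_iii_def Fredholm_all_def by (rule diagonal_of_Fredholm[OF assms(1) Phi])
  qed
qed

end
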